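(* Let $\gamma$ be the standard Gaussian measure on $\mathbb{R}^n$, let $f:\mathbb{R}^n\to\mathbb{R}$ be twice-differentiable, and suppose that $d\nu = e^f\,d\gamma$ defines a probability measure $\nu$ on $\mathbb{R}^n$. Assume that the relative entropy $\mathrm{D_{KL}}(\nu\,||\,\gamma)=\int_{\mathbb{R}^n} f\,d\nu$ and the Fisher information $\mathcal{I}(\nu)=\int_{\mathbb{R}^n}|\nabla f|^2\,d\nu$ are finite. Let $K=\{\nabla f(x): x\in\mathbb{R}^n\}$, assume that $y\mapsto \sup_{t\in K}\langle y,t\rangle$ is integrable with respect to $\gamma$, and set $\mathcal{D}(\nu)=\int_{\mathbb{R}^n}\sup_{t\in K}\langle y,t\rangle\,d\gamma(y)$. Set $M=-\inf_{x\in\mathbb{R}^n}\Delta f(x)$ and assume that $M$ is finite. Then $$\frac12\,\mathcal{I}(\nu)\;\leq\;\mathrm{D_{KL}}\big(\nu\,||\,\gamma\big)+M+\mathcal{D}(\nu).$$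
   Context: $\langle\cdot,\cdot\rangle$ and $|\cdot|$ denote the Euclidean inner product and norm on $\mathbb{R}^n$, and $\Delta$ is the usual Laplacian. The quantity $\mathcal{D}(\nu)$ is the Gaussian-width of the set $K$ of gradients of $f$. *)

theory Defs
  imports "HOL-Probability.Probability"
begin

definition std_gaussian :: "(real ^ 'n) measure" where
  "std_gaussian = density lborel
     (\<lambda>x. ennreal ((2 * pi) powr (- real CARD('n) / 2) * exp (- (norm x)\<^sup>2 / 2)))"

definition gradient :: "('a::real_inner \<Rightarrow> real) \<Rightarrow> 'a \<Rightarrow> 'a" where
  "gradient f x = (THE D. GDERIV f x :> D)"

definition twice_differentiable :: "('a::real_inner \<Rightarrow> real) \<Rightarrow> bool" where
  "twice_differentiable f \<longleftrightarrow>
     (\<forall>x. f differentiable (at x)) \<and> (\<forall>x. gradient f differentiable (at x))"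

definition partial_derivative :: "'n \<Rightarrow> (real ^ 'n \<Rightarrow> real) \<Rightarrow> real ^ 'n \<Rightarrow> real" where
  "partial_derivative i f x = deriv (\<lambda>t. f (x + t *\<^sub>R axis i 1)) 0"

definition laplacian :: "(real ^ 'n \<Rightarrow> real) \<Rightarrow> real ^ 'n \<Rightarrow> real" where
  "laplacian f x = (\<Sum>i\<in>UNIV. partial_derivative i (partial_derivative i f) x)"

definition fisher_information :: "(real ^ 'n) measure \<Rightarrow> (real ^ 'n \<Rightarrow> real) \<Rightarrow> real" where
  "fisher_information \<nu> f = (\<integral>x. (norm (gradient f x))\<^sup>2 \<partial>\<nu>)"

text \<open>The support function is extended-real-valued because a real-valued supremum of an
  unbounded set would be an arbitrary number. Integrability therefore has to include
  almost-everywhere finiteness.\<close>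

definition support_function :: "(real ^ 'n) set \<Rightarrow> real ^ 'n \<Rightarrow> ereal" where
  "support_function K y = (SUP t\<in>K. ereal (y \<bullet> t))"

definition support_function_integrable :: "(real ^ 'n) set \<Rightarrow> bool" where
  "support_function_integrable K \<longleftrightarrow>
     (AE y in std_gaussian. \<bar>support_function K y\<bar> \<noteq> \<infinity>) \<and>
     integrable std_gaussian (\<lambda>y. real_of_ereal (support_function K y))"

definition gaussian_width :: "(real ^ 'n) set \<Rightarrow> real" where
  "gaussian_width K = (\<integral>y. real_of_ereal (support_function K y) \<partial>std_gaussian)"

lemma GDERIV_gradient:
  fixes f :: "'a::euclidean_space \<Rightarrow> real"
  assumes "f differentiable (at x)"
  shows "GDERIV f x :> gradient f x"
proof -
  obtain f' where f': "(f has_derivative f') (at x)"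
    using assms unfolding differentiable_def by blast
  interpret f': bounded_linear f' using f' by (rule has_derivative_bounded_linear)
  define D where "D = (\<Sum>b\<in>Basis. f' b *\<^sub>R b)"
  have "f' h = h \<bullet> D" for h
  proof -
    have "f' h = f' (\<Sum>b\<in>Basis. (h \<bullet> b) *\<^sub>R b)" by (simp add: euclidean_representation)
    also have "\<dots> = (\<Sum>b\<in>Basis. (h \<bullet> b) * f' b)" by (simp add: f'.sum f'.scaleR)
    also have "\<dots> = h \<bullet> D" by (simp add: D_def inner_sum_right mult.commute)
    finally show ?thesis .
  qed
  then have D: "GDERIV f x :> D" using f' unfolding gderiv_def by (metis (no_types, lifting) ext)
  moreover have "E = D" if "GDERIV f x :> E" for E
  proof -
    have "(\<lambda>h. h \<bullet> E) = (\<lambda>h. h \<bullet> D)"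
      using that D unfolding gderiv_def by (rule has_derivative_unique)
    then have "(E - D) \<bullet> E = (E - D) \<bullet> D" by metis
    then show ?thesis by (metis inner_diff_right inner_eq_zero_iff right_minus_eq)
  qed
  ultimately show ?thesis unfolding gradient_def by (metis (mono_tags, lifting) theI)
qed

lemma gradient_nth:
  fixes f :: "real ^ 'n \<Rightarrow> real"
  assumes "f differentiable (at x)"
  shows "gradient f x $ i = partial_derivative i f x"
proof -
  have d: "(f has_derivative (\<lambda>h. h \<bullet> gradient f x)) (at (x + 0 *\<^sub>R axis i 1))"
    using GDERIV_gradient[OF assms] by (simp add: gderiv_def)
  have "((\<lambda>t. x + t *\<^sub>R axis i 1) has_derivative (\<lambda>t. t *\<^sub>R axis i 1)) (at (0::real))"
    by (auto intro!: derivative_eq_intros)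
  from has_derivative_compose[OF this d]
  have "((\<lambda>t. f (x + t *\<^sub>R axis i 1)) has_field_derivative (gradient f x $ i)) (at 0)"
    unfolding has_field_derivative_def
    by (rule has_derivative_eq_rhs) (simp add: inner_axis' mult.commute fun_eq_iff)
  then show ?thesis unfolding partial_derivative_def by (simp add: DERIV_imp_deriv)
qed

lemma KL_divergence_exp_density:
  fixes f :: "real ^ 'n \<Rightarrow> real"
  assumes [measurable]: "f \<in> borel_measurable borel"
  defines "\<nu> \<equiv> density std_gaussian (\<lambda>x. ennreal (exp (f x)))"
  shows "KL_divergence (exp 1) std_gaussian \<nu> = (\<integral>x. f x \<partial>\<nu>)"
proof -
  interpret sigma_finite_measure "std_gaussian :: (real ^ 'n) measure"
    unfolding std_gaussian_def by (subst sigma_finite_measure.sigma_finite_iff_density_finite[OF lborel.sigma_finite_measure_axioms]) auto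
  have [measurable]: "f \<in> borel_measurable std_gaussian"
    by (simp add: std_gaussian_def)
  show ?thesis
    unfolding \<nu>_def by (subst KL_density) (auto simp: integral_real_density log_def)
qed

end

theory Submission
  imports Defs
begin

text \<open>Let \<open>p\<close> be the Lebesgue density of \<open>\<nu>\<close> and \<open>C\<close> the closed convex hull of \<open>K\<close>, which is compact because the
  support function of \<open>K\<close> is finite almost everywhere. The divergence theorem for the field \<open>p \<nabla>f\<close> gives
  \<open>\<integral>|\<nabla>f|\<^sup>2 d\<nu> \<le> M + \<integral>x\<bullet>\<nabla>f d\<nu>\<close> (up to a cutoff). Since \<open>\<nabla>f(x)\<close> lies in \<open>C\<close>,
  \<open>x\<bullet>\<nabla>f - |\<nabla>f|\<^sup>2/2 \<le> \<phi>(x)\<close> where \<open>\<phi>(x) = (|x|\<^sup>2 - dist(x,C)\<^sup>2)/2\<close>, and by Gibbs' variational principle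
  \<open>\<integral>\<phi> d\<nu>\<close> is at most the relative entropy plus \<open>log \<integral>exp \<phi> d\<gamma>\<close>. Finally \<open>\<integral>exp \<phi> d\<gamma>\<close> is the
  Wills functional of \<open>C\<close>, whose logarithm is at most the Gaussian width.

  As the second derivatives of \<open>f\<close> need not be integrable, the divergence theorem is only used as an
  inequality, proved by bisection as in Goursat's lemma.\<close>

section \<open>The divergence inequality for differentiable vector fields\<close>


text \<open>Two integrability obstacles shape the argument. The Laplacian is controlled only from
  below, so the divergence of the field is never integrated: replacing \<open>laplacian f\<close> by
  \<open>- M\<close> gives a continuous minorant of the divergence, and only that minorant is
  compared with the flux. Likewise the term x\<bullet>\<nabla>f is never integrated without a
  cutoff. It is bounded pointwise by integrable functions while the cutoff is still present, which
  is why Gibbs' principle is used in the pointwise form p(1 + t) \<le> p exp t with t = \<phi> - f -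
  D, where D is the Gaussian width. The factor 1/2 in the conclusion comes from completing the
  square: bounding x\<bullet>\<nabla>f costs |\<nabla>f|^2/2, so half of the Fisher information
  survives. The Wills functional appears because the factor exp(|x|^2/2) of exp \<phi> cancels the
  Gaussian weight and leaves exp(-dist(x,C)^2/2). Convexity of C, the reason for leaving K, enters
  through the joint convexity of (s,x) \<mapsto> dist(x, s C), which is what Prekopa's theorem turns
  into log-concavity of s \<mapsto> W(s C).\<close>

definition coord_update :: "'a::euclidean_space \<Rightarrow> 'a \<Rightarrow> real \<Rightarrow> 'a" where
  "coord_update x k c = x + (c - x \<bullet> k) *\<^sub>R k"

lemma inner_coord_update:
  assumes "k \<in> Basis" "j \<in> Basis"
  shows "coord_update x k c \<bullet> j = (if j = k then c else x \<bullet> j)"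
  using assms by (auto simp: coord_update_def inner_add_left inner_Basis)

lemma continuous_on_coord_update [continuous_intros]:
  "continuous_on S (\<lambda>x. coord_update x k c)"
  unfolding coord_update_def by (intro continuous_intros)

lemma cbox_split_coord_update:
  fixes a b :: "'a::euclidean_space"
  assumes k: "k \<in> Basis" and "a \<bullet> k \<le> m" "m \<le> b \<bullet> k"
  shows "cbox a b \<inter> {x. x \<bullet> k \<le> m} = cbox a (coord_update b k m)"
    and "cbox a b \<inter> {x. m \<le> x \<bullet> k} = cbox (coord_update a k m) b"
  using assms by (auto simp: mem_box inner_coord_update split: if_splits; force)+

lemma integral_cbox_split:
  fixes F :: "'a::euclidean_space \<Rightarrow> real"
  assumes "k \<in> Basis" "a \<bullet> k \<le> m" "m \<le> b \<bullet> k" "continuous_on UNIV F"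
  shows "integral (cbox a b) F
    = integral (cbox a (coord_update b k m)) F + integral (cbox (coord_update a k m) b) F"
proof -
  have "F integrable_on cbox a b"
    using assms(4) by (intro integrable_continuous) (rule continuous_on_subset, auto)
  from integral_split[OF this assms(1), of m] show ?thesis
    unfolding cbox_split_coord_update[OF assms(1-3)] .
qed

lemma content_coord_update:
  fixes a b :: "'a::euclidean_space"
  assumes k: "k \<in> Basis" and ab: "\<And>i. i \<in> Basis \<Longrightarrow> a \<bullet> i < b \<bullet> i"
    and m: "m = (a \<bullet> k + b \<bullet> k) / 2"
  shows "measure lborel (cbox a (coord_update b k m)) = measure lborel (cbox a b) / 2"
    and "measure lborel (cbox (coord_update a k m) b) = measure lborel (cbox a b) / 2"
proof -
  have *: "(\<Prod>i\<in>Basis. f i) = f k * (\<Prod>i\<in>Basis - {k}. f i)" for f :: "'a \<Rightarrow> real"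
    using k by (simp add: prod.remove)
  have mm: "a \<bullet> k < m" "m < b \<bullet> k" using ab[OF k] by (auto simp: m field_simps)
  have 1: "(\<Prod>i\<in>Basis. coord_update b k m \<bullet> i - a \<bullet> i) = (\<Prod>i\<in>Basis. b \<bullet> i - a \<bullet> i) / 2"
    unfolding * using k by (simp add: inner_coord_update m field_simps)
  have 2: "(\<Prod>i\<in>Basis. b \<bullet> i - coord_update a k m \<bullet> i) = (\<Prod>i\<in>Basis. b \<bullet> i - a \<bullet> i) / 2"
    unfolding * using k by (simp add: inner_coord_update m field_simps)
  have le: "\<And>i. i \<in> Basis \<Longrightarrow> a \<bullet> i \<le> b \<bullet> i" using ab less_imp_le by blast
  show "measure lborel (cbox a (coord_update b k m)) = measure lborel (cbox a b) / 2"
    using 1 le k mm by (simp add: content_cbox_if box_eq_empty inner_coord_update)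
      (auto simp: not_less[symmetric] dest: le split: if_splits)
  show "measure lborel (cbox (coord_update a k m) b) = measure lborel (cbox a b) / 2"
    using 2 le k mm by (simp add: content_cbox_if box_eq_empty inner_coord_update)
      (auto simp: not_less[symmetric] dest: le split: if_splits)
qed

text \<open>The flux of \<open>w\<close> through the boundary of a box: the integral over the face orthogonal to \<open>i\<close>
  is written as the integral over the whole box of a function not depending on coordinate \<open>i\<close>,
  divided by the side length.\<close>

definition box_flux :: "('a::euclidean_space \<Rightarrow> 'a) \<Rightarrow> 'a \<Rightarrow> 'a \<Rightarrow> real" where
  "box_flux w a b = (\<Sum>i\<in>Basis.
     integral (cbox a b) (\<lambda>x. w (coord_update x i (b \<bullet> i)) \<bullet> i - w (coord_update x i (a \<bullet> i)) \<bullet> i)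
       / (b \<bullet> i - a \<bullet> i))"

text \<open>For \<open>i \<noteq> k\<close> the faces are cut along with the box. For
  \<open>i = k\<close> the common face is left by one half and entered by the other, so its two
  contributions cancel; halving the side in the denominator compensates for integrating over half of
  the volume.\<close>

lemma box_flux_bisect:
  fixes w :: "'a::euclidean_space \<Rightarrow> 'a"
  assumes w: "continuous_on UNIV w" and k: "k \<in> Basis"
    and ab: "\<And>i. i \<in> Basis \<Longrightarrow> a \<bullet> i < b \<bullet> i" and m: "m = (a \<bullet> k + b \<bullet> k) / 2"
  shows "box_flux w a b = box_flux w a (coord_update b k m) + box_flux w (coord_update a k m) b"
proof -
  have mm: "a \<bullet> k \<le> m" "m \<le> b \<bullet> k" using ab[OF k] by (auto simp: m)
  define G where "G i c = (\<lambda>x. w (coord_update x i c) \<bullet> i)" for i c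
  have cG: "continuous_on S (G i c)" for i c S
    unfolding G_def
    by (intro continuous_intros continuous_on_compose2[OF w]) auto
  then have iG: "G i c integrable_on cbox x y" for i c x y
    by (intro integrable_continuous)
  note split = integral_cbox_split[OF k mm]
  have flux: "box_flux w x y = (\<Sum>i\<in>Basis. (integral (cbox x y) (G i (y \<bullet> i))
      - integral (cbox x y) (G i (x \<bullet> i))) / (y \<bullet> i - x \<bullet> i))" for x y
    unfolding box_flux_def by (subst integral_diff[symmetric]) (auto simp: iG, simp add: G_def)
  have shift: "integral (cbox a (coord_update b k m)) (G k c) = integral (cbox (coord_update a k m) b) (G k c)" for c
  proof -
    \<comment> \<open>Translation by half a side carries the lower half onto the upper half, and
      \<open>G k c\<close> ignores the coordinate that is moved.\<close>
    define s where "s = ((b \<bullet> k - a \<bullet> k) / 2) *\<^sub>R k"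
    have "coord_update a k m - s = a" "b - s = coord_update b k m"
      by (auto simp: coord_update_def s_def m scaleR_left_diff_distrib[symmetric] algebra_simps simp flip: scaleR_add_left)
         (auto simp: field_simps)
    moreover have "(\<lambda>x. G k c (x + s)) = G k c"
      using k by (auto simp: G_def coord_update_def s_def inner_add_left algebra_simps)
    ultimately show ?thesis
      using integral_shift_cbox[of "coord_update a k m" s b "G k c"] by simp
  qed
  show ?thesis
    unfolding flux sum.distrib[symmetric]
  proof (rule sum.cong[OF refl])
    fix i :: 'a assume i: "i \<in> Basis"
    show "(integral (cbox a b) (G i (b \<bullet> i)) - integral (cbox a b) (G i (a \<bullet> i))) / (b \<bullet> i - a \<bullet> i) =
      (integral (cbox a (coord_update b k m)) (G i (coord_update b k m \<bullet> i))
         - integral (cbox a (coord_update b k m)) (G i (a \<bullet> i))) / (coord_update b k m \<bullet> i - a \<bullet> i) +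
      (integral (cbox (coord_update a k m) b) (G i (b \<bullet> i))
         - integral (cbox (coord_update a k m) b) (G i (coord_update a k m \<bullet> i))) / (b \<bullet> i - coord_update a k m \<bullet> i)"
    proof (cases "i = k")
      case False
      then show ?thesis using i k
        by (simp add: inner_coord_update split[OF cG] add_divide_distrib[symmetric])
    next
      case True
      have half: "m - a \<bullet> k = (b \<bullet> k - a \<bullet> k) / 2" "b \<bullet> k - m = (b \<bullet> k - a \<bullet> k) / 2"
        by (auto simp: m field_simps)
      show ?thesis using k True ab[OF k]
        by (simp add: inner_coord_update split[OF cG] shift half add_divide_distrib[symmetric])
    qed
  qed
qed

text \<open>An affine field has flux exactly trace times volume. The remainder is small relative to
  the diameter, and the flux divides it by a side length; the bound on the ratios of the sides keeps
  that quotient under control.\<close>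

lemma box_flux_near_point:
  fixes w :: "'a::euclidean_space \<Rightarrow> 'a"
  assumes w: "continuous_on UNIV w" and w': "(w has_derivative w') (at x)" and "e > 0"
  shows "\<exists>d>0. \<forall>a b. x \<in> cbox a b \<longrightarrow> (\<forall>i\<in>Basis. a \<bullet> i < b \<bullet> i)
       \<longrightarrow> (\<forall>i\<in>Basis. \<forall>j\<in>Basis. b \<bullet> i - a \<bullet> i \<le> 2 * (b \<bullet> j - a \<bullet> j))
       \<longrightarrow> cbox a b \<subseteq> ball x d
       \<longrightarrow> \<bar>box_flux w a b - (\<Sum>i\<in>Basis. w' i \<bullet> i) * measure lborel (cbox a b)\<bar> \<le> e * measure lborel (cbox a b)"
proof -
  define n where "n = real DIM('a)"
  have n: "n > 0" by (simp add: n_def)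
  \<comment> \<open>A point of the box is within \<open>2 * n * s\<close> of \<open>x\<close>, where
    \<open>s\<close> is the side in direction \<open>i\<close>. Two opposite faces give an error
    \<open>4 * \<delta> * n\<close> per unit volume in each direction, and the \<open>n\<close>
    directions add up to \<open>e\<close>.\<close>
  define \<delta> where "\<delta> = e / (4 * n * n)"
  have \<delta>: "\<delta> > 0" using \<open>e > 0\<close> n by (simp add: \<delta>_def)
  obtain d where d: "d > 0" "\<And>y. norm (y - x) < d \<Longrightarrow> norm (w y - w x - w' (y - x)) \<le> \<delta> * norm (y - x)"
    using w' \<delta> unfolding has_derivative_at_alt by blast
  interpret w': bounded_linear w' using w' by (rule has_derivative_bounded_linear)
  show ?thesis
  proof (rule exI[of _ d], intro conjI allI impI, rule d(1))
    fix a b :: 'a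
    assume x: "x \<in> cbox a b" and ab': "\<forall>i\<in>Basis. a \<bullet> i < b \<bullet> i"
      and ecc': "\<forall>i\<in>Basis. \<forall>j\<in>Basis. b \<bullet> i - a \<bullet> i \<le> 2 * (b \<bullet> j - a \<bullet> j)"
      and small: "cbox a b \<subseteq> ball x d"
    note ab = bspec[OF ab'] and ecc = bspec[OF bspec[OF ecc']]
    define V where "V = measure lborel (cbox a b)"
    have V: "V \<ge> 0" by (simp add: V_def)
    have termwise: "\<bar>integral (cbox a b) (\<lambda>y. w (coord_update y i (b \<bullet> i)) \<bullet> i - w (coord_update y i (a \<bullet> i)) \<bullet> i)
        / (b \<bullet> i - a \<bullet> i) - w' i \<bullet> i * V\<bar> \<le> 4 * \<delta> * n * V" if i: "i \<in> Basis" for i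
    proof -
      define s where "s = b \<bullet> i - a \<bullet> i"
      have s: "s > 0" using ab[OF i] by (simp add: s_def)
      have r: "norm (w u - w x - w' (u - x)) \<le> 2 * \<delta> * n * s" if u: "u \<in> cbox a b" for u
      proof -
        have "norm (u - x) \<le> (\<Sum>j\<in>Basis. \<bar>(u - x) \<bullet> j\<bar>)" by (rule norm_le_l1)
        also have "\<dots> \<le> (\<Sum>j\<in>(Basis::'a set). 2 * s)"
        proof (rule sum_mono)
          fix j :: 'a assume j: "j \<in> Basis"
          have "\<bar>(u - x) \<bullet> j\<bar> \<le> b \<bullet> j - a \<bullet> j"
            using u x j by (auto simp: mem_box inner_diff_left abs_le_iff dest!: bspec[of _ _ j])
          also have "\<dots> \<le> 2 * s" unfolding s_def by (rule ecc[OF j i])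
          finally show "\<bar>(u - x) \<bullet> j\<bar> \<le> 2 * s" .
        qed
        also have "\<dots> = 2 * n * s" by (simp add: n_def)
        finally have "norm (u - x) \<le> 2 * n * s" .
        moreover have "norm (u - x) < d" using small u by (auto simp: dist_norm norm_minus_commute)
        ultimately show ?thesis
          using order_trans[OF d(2)[of u] mult_left_mono[of "norm (u - x)" "2 * n * s" \<delta>]] \<delta>
          by (simp add: mult_ac)
      qed
      have pt: "norm (w (coord_update y i (b \<bullet> i)) \<bullet> i - w (coord_update y i (a \<bullet> i)) \<bullet> i - s * (w' i \<bullet> i))
          \<le> 4 * \<delta> * n * s" if y: "y \<in> cbox a b" for y
      proof -
        let ?u = "coord_update y i (b \<bullet> i)" and ?v = "coord_update y i (a \<bullet> i)"
        have in1: "?u \<in> cbox a b" "?v \<in> cbox a b"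
          using y i ab by (auto simp: mem_box inner_coord_update less_imp_le)
        have "?u - ?v = s *\<^sub>R i" by (simp add: coord_update_def s_def algebra_simps)
        then have "w' ((?u - x) - (?v - x)) = w' (s *\<^sub>R i)"
          by simp
        then have lin: "w' (?u - x) = w' (?v - x) + s *\<^sub>R w' i"
          unfolding w'.diff w'.scaleR by (simp add: algebra_simps)
        have "(w ?u \<bullet> i - w ?v \<bullet> i - s * (w' i \<bullet> i))
            = ((w ?u - w x - w' (?u - x)) - (w ?v - w x - w' (?v - x))) \<bullet> i"
          unfolding lin by (simp only: inner_diff_left inner_add_left inner_scaleR_left)
        also have "norm \<dots> \<le> norm ((w ?u - w x - w' (?u - x)) - (w ?v - w x - w' (?v - x)))"
          using i Basis_le_norm by (metis real_norm_def)
        also have "\<dots> \<le> 4 * \<delta> * n * s"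
          using r[OF in1(1)] r[OF in1(2)] by (intro order_trans[OF norm_triangle_ineq4]) linarith
        finally show ?thesis .
      qed
      let ?F = "\<lambda>y. w (coord_update y i (b \<bullet> i)) \<bullet> i - w (coord_update y i (a \<bullet> i)) \<bullet> i"
      have iF: "?F integrable_on cbox a b"
        by (intro integrable_continuous continuous_intros continuous_on_compose2[OF w]) auto
      have "((\<lambda>y. ?F y - s * (w' i \<bullet> i)) has_integral (integral (cbox a b) ?F - V * (s * (w' i \<bullet> i)))) (cbox a b)"
        using has_integral_diff[OF integrable_integral[OF iF] has_integral_const[of "s * (w' i \<bullet> i)" a b]]
        by (simp add: V_def)
      from has_integral_bound[OF _ this, of "4 * \<delta> * n * s"] pt \<delta> n s
      have *: "\<bar>integral (cbox a b) ?F - V * (s * (w' i \<bullet> i))\<bar> \<le> 4 * \<delta> * n * s * V"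
        by (simp add: V_def)
      have "integral (cbox a b) ?F / s - (w' i \<bullet> i) * V = (integral (cbox a b) ?F - V * (s * (w' i \<bullet> i))) / s"
        using s by (simp add: field_simps)
      then have "\<bar>integral (cbox a b) ?F / s - (w' i \<bullet> i) * V\<bar> = \<bar>integral (cbox a b) ?F - V * (s * (w' i \<bullet> i))\<bar> / s"
        using s by simp
      also have "\<dots> \<le> 4 * \<delta> * n * V"
        using * s by (simp add: field_simps)
      finally show ?thesis by (simp add: s_def)
    qed
    have "\<bar>box_flux w a b - (\<Sum>i\<in>Basis. w' i \<bullet> i) * V\<bar> \<le> (\<Sum>i\<in>(Basis::'a set). 4 * \<delta> * n * V)"
      unfolding box_flux_def sum_distrib_right sum_subtractf[symmetric]
      by (rule order_trans[OF sum_abs sum_mono]) (rule termwise)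
    also have "\<dots> = e * V" using n by (simp add: \<delta>_def n_def[symmetric])
    finally show "\<bar>box_flux w a b - (\<Sum>i\<in>Basis. w' i \<bullet> i) * measure lborel (cbox a b)\<bar> \<le> e * measure lborel (cbox a b)"
      by (simp add: V_def)
  qed
qed

text \<open>A bounded eccentricity of the boxes is what makes the error in \<open>box_flux_near_point\<close>
  proportional to the volume, so the longest side is bisected at each step of a Goursat argument.\<close>

lemma integral_le_box_flux:
  fixes w :: "'a::euclidean_space \<Rightarrow> 'a" and g :: "'a \<Rightarrow> real"
  assumes w': "\<And>x. (w has_derivative w' x) (at x)" and g: "continuous_on UNIV g"
    and div: "\<And>x. g x \<le> (\<Sum>i\<in>Basis. w' x i \<bullet> i)"
    and ab: "\<And>i. i \<in> Basis \<Longrightarrow> a \<bullet> i < b \<bullet> i"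
    and ecc: "\<And>i j. i \<in> Basis \<Longrightarrow> j \<in> Basis \<Longrightarrow> b \<bullet> i - a \<bullet> i \<le> 2 * (b \<bullet> j - a \<bullet> j)"
  shows "integral (cbox a b) g \<le> box_flux w a b"
proof (rule ccontr)
  assume contra: "\<not> integral (cbox a b) g \<le> box_flux w a b"
  have w: "continuous_on UNIV w"
    using w' has_derivative_continuous by (metis continuous_at_imp_continuous_on)
  define Fl where "Fl p = box_flux w (fst p) (snd p) - integral (cbox (fst p) (snd p)) g" for p :: "'a \<times> 'a"
  define V where "V p = measure lborel (cbox (fst p) (snd p))" for p :: "'a \<times> 'a"
  have Vpos: "V (a, b) > 0" using ab by (auto simp: V_def content_pos_lt)
  \<comment> \<open>The defect of the initial box is \<open>2 * \<epsilon>\<close> per unit volume.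
    Keeping only a strict defect of more than \<open>\<epsilon>\<close> leaves room for two errors
    of \<open>\<epsilon> / 2\<close> in the limit: one from linearising \<open>w\<close>, one from
    the continuity of \<open>g\<close>.\<close>
  define \<epsilon> where "\<epsilon> = - Fl (a, b) / (2 * V (a, b))"
  have Fl0: "Fl (a, b) < 0" using contra by (simp add: Fl_def)
  have \<epsilon>: "\<epsilon> > 0" using Fl0 Vpos by (simp add: \<epsilon>_def divide_neg_pos)
  define good where "good p \<longleftrightarrow> (\<forall>i\<in>Basis. fst p \<bullet> i < snd p \<bullet> i)
     \<and> (\<forall>i\<in>Basis. \<forall>j\<in>Basis. snd p \<bullet> i - fst p \<bullet> i \<le> 2 * (snd p \<bullet> j - fst p \<bullet> j))
     \<and> Fl p < - \<epsilon> * V p" for p :: "'a \<times> 'a"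
  have good0: "good (a, b)"
    unfolding good_def using ab ecc Fl0 Vpos by (auto simp: \<epsilon>_def)
  have step: "\<exists>q. good q \<and> cbox (fst q) (snd q) \<subseteq> cbox (fst p) (snd p) \<and> V q = V p / 2" if p: "good p" for p
  proof -
    obtain c d where p_eq: "p = (c, d)" by (cases p)
    have cd: "\<And>i. i \<in> Basis \<Longrightarrow> c \<bullet> i < d \<bullet> i"
      and cde: "\<And>i j. i \<in> Basis \<Longrightarrow> j \<in> Basis \<Longrightarrow> d \<bullet> i - c \<bullet> i \<le> 2 * (d \<bullet> j - c \<bullet> j)"
      and Flp: "Fl (c, d) < - \<epsilon> * V (c, d)"
      using p by (auto simp: good_def p_eq)
    obtain k :: 'a where k: "k \<in> Basis" and kmax: "\<And>i. i \<in> Basis \<Longrightarrow> d \<bullet> i - c \<bullet> i \<le> d \<bullet> k - c \<bullet> k"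
    proof -
      let ?S = "(\<lambda>i. d \<bullet> i - c \<bullet> i) ` (Basis :: 'a set)"
      have "Max ?S \<in> ?S" by (intro Max_in) auto
      then obtain k :: 'a where "k \<in> Basis" "Max ?S = d \<bullet> k - c \<bullet> k" by blast
      moreover have "d \<bullet> i - c \<bullet> i \<le> Max ?S" if "i \<in> Basis" for i
        using that by (intro Max_ge) auto
      ultimately show ?thesis using that by simp
    qed
    define m where "m = (c \<bullet> k + d \<bullet> k) / 2"
    have mm: "c \<bullet> k < m" "m < d \<bullet> k" using cd[OF k] by (auto simp: m_def field_simps)
    let ?p = "(c, coord_update d k m)" and ?q = "(coord_update c k m, d)"
    have Vh: "V ?p = V (c, d) / 2" "V ?q = V (c, d) / 2"
      unfolding V_def using content_coord_update[OF k cd m_def] by auto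
    have "Fl (c, d) = Fl ?p + Fl ?q"
      unfolding Fl_def using box_flux_bisect[OF w k cd m_def] integral_cbox_split[OF k less_imp_le less_imp_le g, OF mm]
      by simp
    then have "Fl ?p < - \<epsilon> * V ?p \<or> Fl ?q < - \<epsilon> * V ?q"
      using Flp unfolding Vh by (auto simp: field_simps)
    moreover have sub: "cbox c (coord_update d k m) \<subseteq> cbox c d" "cbox (coord_update c k m) d \<subseteq> cbox c d"
      unfolding cbox_split_coord_update[OF k less_imp_le less_imp_le, OF mm, symmetric] by auto
    moreover have ok: "\<forall>i\<in>Basis. c \<bullet> i < coord_update d k m \<bullet> i" "\<forall>i\<in>Basis. coord_update c k m \<bullet> i < d \<bullet> i"
      using cd mm k by (auto simp: inner_coord_update)
    \<comment> \<open>Halving side \<open>k\<close> can spoil the ratio bound only when the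
      shortened side is the one on the right, and then twice its length is the old side
      \<open>k\<close>, which was the longest.\<close>
    moreover have "coord_update d k m \<bullet> i - c \<bullet> i \<le> 2 * (coord_update d k m \<bullet> j - c \<bullet> j)
        \<and> d \<bullet> i - coord_update c k m \<bullet> i \<le> 2 * (d \<bullet> j - coord_update c k m \<bullet> j)"
      if i: "i \<in> Basis" and j: "j \<in> Basis" for i j
    proof -
      have half: "m - c \<bullet> k = (d \<bullet> k - c \<bullet> k) / 2" "d \<bullet> k - m = (d \<bullet> k - c \<bullet> k) / 2"
        by (auto simp: m_def field_simps)
      show ?thesis
        using cde[OF i j] cde[OF k j] kmax[OF i] cd[OF k] cd[OF i]
        unfolding inner_coord_update[OF k i] inner_coord_update[OF k j]
        by (cases "i = k"; cases "j = k"; simp add: half)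
    qed
    ultimately have "good ?p \<or> good ?q" unfolding good_def by auto
    with sub Vh show ?thesis unfolding p_eq by (metis fst_conv snd_conv)
  qed
  have "\<exists>P. \<forall>n::nat. (good (P n) \<and> (n = 0 \<longrightarrow> P n = (a, b)))
      \<and> (cbox (fst (P (Suc n))) (snd (P (Suc n))) \<subseteq> cbox (fst (P n)) (snd (P n)) \<and> V (P (Suc n)) = V (P n) / 2)"
  proof (rule dependent_nat_choice)
    show "\<exists>p. good p \<and> ((0::nat) = 0 \<longrightarrow> p = (a, b))" using good0 by blast
    show "\<exists>q. (good q \<and> (Suc n = 0 \<longrightarrow> q = (a, b)))
        \<and> cbox (fst q) (snd q) \<subseteq> cbox (fst p) (snd p) \<and> V q = V p / 2"
      if "good p \<and> (n = 0 \<longrightarrow> p = (a, b))" for p n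
      using step[of p] that by blast
  qed
  then obtain P where P_all: "\<forall>n::nat. (good (P n) \<and> (n = 0 \<longrightarrow> P n = (a, b)))
      \<and> (cbox (fst (P (Suc n))) (snd (P (Suc n))) \<subseteq> cbox (fst (P n)) (snd (P n)) \<and> V (P (Suc n)) = V (P n) / 2)" ..
  have P: "good (P n)" "P 0 = (a, b)"
      "cbox (fst (P (Suc n))) (snd (P (Suc n))) \<subseteq> cbox (fst (P n)) (snd (P n))"
      "V (P (Suc n)) = V (P n) / 2" for n
    using P_all[rule_format, of n] P_all[rule_format, of 0] by simp_all
  define Q where "Q n = cbox (fst (P n)) (snd (P n))" for n
  have VP: "V (P n) = V (a, b) / 2 ^ n" for n
    by (induction n) (simp_all add: P)
  have "\<Inter>(range Q) \<noteq> {}"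
  proof (rule compact_nest)
    show "compact (Q n)" for n by (simp add: Q_def)
    show "Q n \<noteq> {}" for n
      using P(1)[of n] by (auto simp: Q_def good_def box_ne_empty less_imp_le)
    show "Q n \<subseteq> Q m" if "m \<le> n" for m n
      using that by (rule lift_Suc_antimono_le[rotated]) (simp add: Q_def P)
  qed
  then obtain x where x: "\<And>n. x \<in> Q n" by auto
  obtain d1 where d1: "d1 > 0" "\<forall>a b. x \<in> cbox a b \<longrightarrow> (\<forall>i\<in>Basis. a \<bullet> i < b \<bullet> i)
       \<longrightarrow> (\<forall>i\<in>Basis. \<forall>j\<in>Basis. b \<bullet> i - a \<bullet> i \<le> 2 * (b \<bullet> j - a \<bullet> j))
       \<longrightarrow> cbox a b \<subseteq> ball x d1
       \<longrightarrow> \<bar>box_flux w a b - (\<Sum>i\<in>Basis. w' x i \<bullet> i) * measure lborel (cbox a b)\<bar> \<le> \<epsilon> / 2 * measure lborel (cbox a b)"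
    using box_flux_near_point[OF w w'[of x] half_gt_zero[OF \<epsilon>]] by blast
  obtain d2 where d2: "d2 > 0" "\<And>y. dist y x < d2 \<Longrightarrow> dist (g y) (g x) < \<epsilon> / 2"
    using g[unfolded continuous_on_iff, rule_format, of x "\<epsilon> / 2"] \<epsilon> by auto
  define d where "d = min d1 d2"
  have d: "d > 0" using d1 d2 by (simp add: d_def)
  define N where "N = real DIM('a)"
  have N: "N > 0" by (simp add: N_def)
  have "(\<lambda>n. V (a, b) / 2 ^ n) \<longlonglongrightarrow> 0"
    by (intro LIMSEQ_divide_realpow_zero) auto
  \<comment> \<open>A volume below this forces one side below \<open>d / (4 * N)\<close>; the ratio
    bound then puts all sides below \<open>d / (2 * N)\<close>, and the l1 norm bounds distances in
    the box by \<open>d / 2\<close>.\<close>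
  moreover have "(d / (4 * N)) ^ DIM('a) > 0" using d N by simp
  ultimately obtain n where n: "V (P n) < (d / (4 * N)) ^ DIM('a)"
    unfolding VP using order_tendstoD(2) eventually_happens by (metis sequentially_bot)
  obtain a' b' where Pn: "P n = (a', b')" by (cases "P n")
  have ab': "\<And>i. i \<in> Basis \<Longrightarrow> a' \<bullet> i < b' \<bullet> i"
      and ecc': "\<And>i j. i \<in> Basis \<Longrightarrow> j \<in> Basis \<Longrightarrow> b' \<bullet> i - a' \<bullet> i \<le> 2 * (b' \<bullet> j - a' \<bullet> j)"
      and Flp': "Fl (a', b') < - \<epsilon> * V (a', b')"
      using P(1)[of n] by (auto simp: good_def Pn)
  have xn: "x \<in> cbox a' b'" using x[of n] by (simp add: Q_def Pn)
  have small: "cbox a' b' \<subseteq> ball x d"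
  proof
    fix y assume y: "y \<in> cbox a' b'"
    obtain j :: 'a where j: "j \<in> Basis" "b' \<bullet> j - a' \<bullet> j < d / (4 * N)"
    proof (rule ccontr)
      assume "\<not> thesis"
      then have "\<And>j. j \<in> Basis \<Longrightarrow> d / (4 * N) \<le> b' \<bullet> j - a' \<bullet> j" using that not_less by blast
      then have "(\<Prod>j\<in>(Basis::'a set). d / (4 * N)) \<le> (\<Prod>j\<in>Basis. b' \<bullet> j - a' \<bullet> j)"
        using d N by (intro prod_mono) auto
      also have "\<dots> = V (P n)"
        using ab' by (simp add: V_def Pn content_cbox' box_ne_empty less_imp_le inner_diff_left)
      finally show False using n by simp
    qed
    have "norm (x - y) \<le> (\<Sum>i\<in>Basis. \<bar>(x - y) \<bullet> i\<bar>)" by (rule norm_le_l1)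
    also have "\<dots> \<le> (\<Sum>i\<in>(Basis::'a set). d / (2 * N))"
    proof (rule sum_mono)
      fix i :: 'a assume i: "i \<in> Basis"
      have "a' \<bullet> i \<le> y \<bullet> i" "y \<bullet> i \<le> b' \<bullet> i" "a' \<bullet> i \<le> x \<bullet> i" "x \<bullet> i \<le> b' \<bullet> i"
        using y xn i by (simp_all add: mem_box)
      then have "\<bar>(x - y) \<bullet> i\<bar> \<le> b' \<bullet> i - a' \<bullet> i"
        unfolding inner_diff_left by linarith
      also have "\<dots> \<le> 2 * (b' \<bullet> j - a' \<bullet> j)" by (rule ecc'[OF i j(1)])
      also have "\<dots> \<le> 2 * (d / (4 * N))" using j(2) by (intro mult_left_mono) auto
      finally show "\<bar>(x - y) \<bullet> i\<bar> \<le> d / (2 * N)" by simp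
    qed
    also have "\<dots> = d / 2" using N by (simp add: N_def)
    also have "\<dots> < d" using d by simp
    finally show "y \<in> ball x d" by (simp add: dist_norm)
  qed
  have V': "V (a', b') = measure lborel (cbox a' b')" by (simp add: V_def)
  have V'pos: "V (a', b') > 0" using ab' by (auto simp: V_def content_pos_lt)
  have flux: "\<bar>box_flux w a' b' - (\<Sum>i\<in>Basis. w' x i \<bullet> i) * V (a', b')\<bar> \<le> \<epsilon> / 2 * V (a', b')"
    unfolding V' using small by (intro d1(2)[rule_format] xn ab' ecc') (auto simp: d_def)
  have "integral (cbox a' b') g \<le> integral (cbox a' b') (\<lambda>_. g x + \<epsilon> / 2)"
  proof (rule integral_le)
    show "g integrable_on cbox a' b'"
      using g by (intro integrable_continuous) (rule continuous_on_subset, auto)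
    fix y assume "y \<in> cbox a' b'"
    then have "dist y x < d2" using small by (auto simp: d_def dist_commute)
    from d2(2)[OF this] show "g y \<le> g x + \<epsilon> / 2" unfolding dist_real_def by linarith
  qed auto
  also have "\<dots> = V (a', b') * (g x + \<epsilon> / 2)" by (simp add: V')
  finally have "integral (cbox a' b') g \<le> V (a', b') * (g x + \<epsilon> / 2)" .
  moreover have "V (a', b') * g x \<le> V (a', b') * (\<Sum>i\<in>Basis. w' x i \<bullet> i)"
    using div[of x] V'pos by (intro mult_left_mono) auto
  moreover have "(\<Sum>i\<in>Basis. w' x i \<bullet> i) * V (a', b') - \<epsilon> / 2 * V (a', b') \<le> box_flux w a' b'"
    using flux by linarith
  ultimately show False
    using Flp' unfolding Fl_def by (simp add: algebra_simps)
qed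

text \<open>On the cube with half side \<open>r\<close> every face point has norm at least
  \<open>r\<close>, so the flux vanishes; outside the cube \<open>g\<close> vanishes as well, so
  nothing of its integral is lost. A cube trivially satisfies the ratio condition on the
  sides.\<close>

lemma integral_nonpos_of_compact_support_divergence:
  fixes w :: "'a::euclidean_space \<Rightarrow> 'a" and g :: "'a \<Rightarrow> real"
  assumes w': "\<And>x. (w has_derivative w' x) (at x)" and g: "continuous_on UNIV g"
    and div: "\<And>x. g x \<le> (\<Sum>i\<in>Basis. w' x i \<bullet> i)"
    and supp: "\<And>x. r \<le> norm x \<Longrightarrow> w x = 0" "\<And>x. r \<le> norm x \<Longrightarrow> g x = 0" and r: "r > 0"
  shows "(\<integral>x. g x \<partial>lborel) \<le> 0"
proof -
  define b :: 'a where "b = (\<Sum>i\<in>Basis. r *\<^sub>R i)"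
  define a where "a = - b"
  have ab: "i \<in> Basis \<Longrightarrow> a \<bullet> i = - r" "i \<in> Basis \<Longrightarrow> b \<bullet> i = r" for i
    by (simp_all add: a_def b_def)
  have flux: "box_flux w a b = 0"
  proof -
    have "w (coord_update x i r) = 0 \<and> w (coord_update x i (- r)) = 0" if i: "i \<in> Basis" for i x
    proof -
      have "\<bar>coord_update x i c \<bullet> i\<bar> \<le> norm (coord_update x i c)" for c
        using i by (rule Basis_le_norm)
      then have "\<bar>c\<bar> \<le> norm (coord_update x i c)" for c
        using i by (simp add: inner_coord_update)
      from this[of r] this[of "- r"] show ?thesis using r by (auto intro!: supp)
    qed
    then show ?thesis unfolding box_flux_def by (simp add: ab)
  qed
  have out: "g x = 0" if nin: "x \<notin> cbox a b" for x
  proof -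
    have "x \<in> cbox a b" if *: "\<And>i. i \<in> Basis \<Longrightarrow> \<bar>x \<bullet> i\<bar> \<le> r"
      unfolding mem_box
    proof
      fix i :: 'a assume "i \<in> Basis"
      with *[of i] show "a \<bullet> i \<le> x \<bullet> i \<and> x \<bullet> i \<le> b \<bullet> i" by (simp add: ab) linarith
    qed
    then obtain i where i: "i \<in> Basis" "\<not> \<bar>x \<bullet> i\<bar> \<le> r"
      using nin by blast
    then show ?thesis using Basis_le_norm[OF i(1), of x] by (intro supp) linarith
  qed
  have cg: "continuous_on (cbox a b) g" using g by (rule continuous_on_subset) auto
  have "(\<integral>x. g x \<partial>lborel) = (\<integral>x. indicator (cbox a b) x *\<^sub>R g x \<partial>lborel)"
    by (intro Bochner_Integration.integral_cong) (auto simp: indicator_def out)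
  also have "\<dots> = integral (cbox a b) g"
    using borel_integrable_compact[OF compact_cbox cg]
    by (subst set_borel_integral_eq_integral(2)[symmetric])
       (simp_all add: set_lebesgue_integral_def set_integrable_def)
  also have "\<dots> \<le> box_flux w a b"
    using r by (intro integral_le_box_flux[OF w' g div]) (auto simp: ab)
  finally show ?thesis by (simp add: flux)
qed

section \<open>The Prekopa inequality\<close>


lemma nn_integral_layer_cake_unit:
  fixes u :: "real \<Rightarrow> real"
  assumes [measurable]: "u \<in> borel_measurable borel" and u: "\<And>z. 0 \<le> u z" "\<And>z. u z \<le> 1"
  shows "(\<integral>\<^sup>+z. ennreal (u z) \<partial>lborel)
    = (\<integral>\<^sup>+r. indicator {0<..<1} r * emeasure lborel {z. r < u z} \<partial>lborel)"
proof -
  have "(\<integral>\<^sup>+z. ennreal (u z) \<partial>lborel)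
      = (\<integral>\<^sup>+z. (\<integral>\<^sup>+r. indicator {0<..<1} r * indicator {z. r < u z} z \<partial>lborel) \<partial>lborel)"
  proof (rule nn_integral_cong)
    fix z
    have "(\<integral>\<^sup>+r. indicator {0<..<1} r * indicator {z. r < u z} z \<partial>lborel)
        = (\<integral>\<^sup>+r. indicator {0<..<u z} r \<partial>lborel)"
      using u(2)[of z] by (intro nn_integral_cong) (auto simp: indicator_def)
    also have "\<dots> = ennreal (u z)" using u(1)[of z] by simp
    finally show "ennreal (u z) = (\<integral>\<^sup>+r. indicator {0<..<1} r * indicator {z. r < u z} z \<partial>lborel)" ..
  qed
  also have "\<dots> = (\<integral>\<^sup>+r. (\<integral>\<^sup>+z. indicator {0<..<1} r * indicator {z. r < u z} z \<partial>lborel) \<partial>lborel)"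
    by (rule lborel_pair.Fubini') measurable
  also have "\<dots> = (\<integral>\<^sup>+r. indicator {0<..<1} r * emeasure lborel {z. r < u z} \<partial>lborel)"
    by (intro nn_integral_cong) (simp add: nn_integral_cmult)
  finally show ?thesis .
qed

text \<open>\<open>A\<close> and \<open>B\<close> may be enlarged to the intervals they span, while
  the convex set \<open>C\<close> already has the length of its span, so only suprema and infima
  have to be compared. Working with a given convex \<open>C\<close> in place of the Minkowski
  combination of \<open>A\<close> and \<open>B\<close> avoids the question whether the latter is
  measurable.\<close>

lemma brunn_minkowski_interval:
  fixes A B C :: "real set"
  assumes ne: "A \<noteq> {}" "B \<noteq> {}" and bdd: "bounded A" "bounded B" "bounded C"
    and C: "convex C" "C \<in> sets borel" and meas: "A \<in> sets borel" "B \<in> sets borel"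
    and l: "0 < l" "l < 1"
    and sub: "\<And>x y. x \<in> A \<Longrightarrow> y \<in> B \<Longrightarrow> l * x + (1 - l) * y \<in> C"
  shows "l * measure lborel A + (1 - l) * measure lborel B \<le> measure lborel C"
proof -
  have len: "measure lborel S \<le> Sup S - Inf S" if S: "S \<noteq> {}" "bounded S" "S \<in> sets borel" for S :: "real set"
  proof -
    have "bdd_above S" "bdd_below S" using S by (auto simp: bounded_imp_bdd_above bounded_imp_bdd_below)
    then have "S \<subseteq> {Inf S..Sup S}" by (auto intro: cInf_lower cSup_upper)
    moreover have "Inf S \<le> Sup S" using S \<open>bdd_above S\<close> \<open>bdd_below S\<close> by (intro cInf_le_cSup)
    moreover have "measure lborel S \<le> measure lborel {Inf S..Sup S}"
      using S \<open>S \<subseteq> {Inf S..Sup S}\<close> by (intro measure_mono_fmeasurable) (auto simp: fmeasurable_def)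
    ultimately show ?thesis by simp
  qed
  have bC: "bdd_above C" "bdd_below C" using bdd by (auto simp: bounded_imp_bdd_above bounded_imp_bdd_below)
  have C_ne: "C \<noteq> {}" using ne sub by blast
  have "{Inf C<..<Sup C} \<subseteq> C"
  proof
    fix z assume z: "z \<in> {Inf C<..<Sup C}"
    obtain c where c: "c \<in> C" "c < z" using z C_ne bC by (auto simp: cInf_less_iff)
    obtain d where d: "d \<in> C" "z < d" using z C_ne bC by (auto simp: less_cSup_iff)
    show "z \<in> C" using C(1) c d by (meson is_interval_convex_1 less_imp_le mem_is_interval_1_I)
  qed
  moreover have "C \<in> fmeasurable lborel"
    using C(2) emeasure_bounded_finite[OF bdd(3)] by (intro fmeasurableI) auto
  ultimately have "measure lborel {Inf C<..<Sup C} \<le> measure lborel C"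
    by (intro measure_mono_fmeasurable) auto
  then have lenC: "Sup C - Inf C \<le> measure lborel C"
    using cInf_le_cSup[OF C_ne bC] by simp
  have up: "l * Sup A + (1 - l) * Sup B \<le> Sup C"
  proof -
    have "x \<le> (Sup C - (1 - l) * y) / l" if "x \<in> A" "y \<in> B" for x y
      using cSup_upper[OF sub[OF that] bC(1)] l by (simp add: field_simps)
    then have supA: "Sup A \<le> (Sup C - (1 - l) * y) / l" if "y \<in> B" for y
      using that ne by (intro cSup_least) auto
    have "y \<le> (Sup C - l * Sup A) / (1 - l)" if "y \<in> B" for y
      using supA[OF that] l by (simp add: field_simps)
    then have "Sup B \<le> (Sup C - l * Sup A) / (1 - l)" using ne by (intro cSup_least) auto
    then show ?thesis using l by (simp add: field_simps)
  qed
  have lo: "Inf C \<le> l * Inf A + (1 - l) * Inf B"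
  proof -
    have "(Inf C - (1 - l) * y) / l \<le> x" if "x \<in> A" "y \<in> B" for x y
      using cInf_lower[OF sub[OF that] bC(2)] l by (simp add: field_simps)
    then have infA: "(Inf C - (1 - l) * y) / l \<le> Inf A" if "y \<in> B" for y
      using that ne by (intro cInf_greatest) auto
    have "(Inf C - l * Inf A) / (1 - l) \<le> y" if "y \<in> B" for y
      using infA[OF that] l by (simp add: field_simps)
    then have "(Inf C - l * Inf A) / (1 - l) \<le> Inf B" using ne by (intro cInf_greatest) auto
    then show ?thesis using l by (simp add: field_simps)
  qed
  have "l * measure lborel A + (1 - l) * measure lborel B \<le> l * (Sup A - Inf A) + (1 - l) * (Sup B - Inf B)"
    using len[OF ne(1) bdd(1) meas(1)] len[OF ne(2) bdd(2) meas(2)] l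
    by (intro add_mono mult_left_mono) auto
  also have "\<dots> \<le> Sup C - Inf C" using up lo by (simp add: algebra_simps)
  finally show ?thesis using lenC by simp
qed

lemma bounded_superlevel_gaussian:
  fixes u :: "real \<Rightarrow> real"
  assumes "\<And>z. u z \<le> B * exp (- z\<^sup>2 / 4)" "r > 0"
  shows "bounded {z. r < u z}"
proof -
  have "\<bar>z\<bar> \<le> 1 + 4 * B / r" if "r < u z" for z
  proof -
    have "r < B * exp (- z\<^sup>2 / 4)" using that assms(1)[of z] by simp
    then have "r * exp (z\<^sup>2 / 4) < B" by (simp add: exp_minus field_simps)
    moreover have "r * (1 + z\<^sup>2 / 4) \<le> r * exp (z\<^sup>2 / 4)"
      using assms(2) exp_ge_add_one_self by (intro mult_left_mono) auto
    ultimately have "z\<^sup>2 \<le> 4 * B / r" using assms(2) by (simp add: field_simps)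
    moreover have "\<bar>z\<bar> \<le> 1 + z\<^sup>2" using zero_le_power2[of "\<bar>z\<bar> - 1 / 2"]
      by (simp add: power2_eq_square algebra_simps)
    ultimately show ?thesis by simp
  qed
  then show ?thesis by (intro boundedI[of _ "1 + 4 * B / r"]) auto
qed

text \<open>The rate 1/4 instead of 1/2 is the price of moving a Gaussian centre within a ball of
  radius \<open>R\<close>: exp(-|x - c|^2/2) \<le> exp(R^2/2) exp(-|x|^2/4). It serves as the common
  envelope of all integrands below.\<close>

lemma integrable_exp_minus_square_div_4:
  "integrable lborel (\<lambda>z::real. exp (- z\<^sup>2 / 4))"
proof -
  have "(\<lambda>z::real. exp (- z\<^sup>2 / 4)) = (\<lambda>z. sqrt (4 * pi) * normal_density 0 (sqrt 2) z)"
    by (auto simp: normal_density_def)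
  then show ?thesis by (simp add: integrable_normal_density)
qed

lemma integrable_gaussian_bound:
  fixes u :: "real \<Rightarrow> real"
  assumes [measurable]: "u \<in> borel_measurable borel" and "\<And>z. 0 < u z" "\<And>z. u z \<le> B * exp (- z\<^sup>2 / 4)"
  shows "integrable lborel u" "0 < (\<integral>z. u z \<partial>lborel)"
proof -
  show *: "integrable lborel u"
    by (rule Bochner_Integration.integrable_bound[OF integrable_mult_right[OF integrable_exp_minus_square_div_4, of B]])
       (use assms in \<open>auto intro!: AE_I2 order_trans[OF _ abs_ge_self] simp: less_imp_le abs_of_pos\<close>)
  have "(\<integral>z. u z \<partial>lborel) \<noteq> 0"
  proof
    assume "(\<integral>z. u z \<partial>lborel) = 0"
    then have "AE z in lborel. u z = 0"
      using integral_nonneg_eq_0_iff_AE[OF *] assms(2) by (simp add: less_imp_le)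
    then have "AE z in (lborel :: real measure). False" using assms(2) by (auto simp: less_le)
    then show False by (simp add: eventually_False ae_filter_eq_bot_iff)
  qed
  then show "0 < (\<integral>z. u z \<partial>lborel)"
    using Bochner_Integration.integral_nonneg[of lborel u] assms(2) by (simp add: less_le)
qed

text \<open>Once both suprema equal 1, the superlevel sets of \<open>u0\<close> and
  \<open>u1\<close> at a level in (0,1) are both nonempty, so the Brunn-Minkowski inequality holds
  level by level and integrates to the arithmetic mean. The function \<open>u\<close> may exceed 1;
  truncating it by \<open>min (u z) 1\<close> only lowers the right-hand side.\<close>

lemma prekopa_leindler_real_normalized:
  fixes u0 u1 u :: "real \<Rightarrow> real"
  assumes [measurable]: "u0 \<in> borel_measurable borel" "u1 \<in> borel_measurable borel" "u \<in> borel_measurable borel"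
    and pos: "\<And>z. 0 < u0 z" "\<And>z. 0 < u1 z" "\<And>z. 0 < u z"
    and bound: "\<And>z. u0 z \<le> B * exp (- z\<^sup>2 / 4)" "\<And>z. u1 z \<le> B * exp (- z\<^sup>2 / 4)" "\<And>z. u z \<le> B * exp (- z\<^sup>2 / 4)"
    and conv: "\<And>r. convex {z. r < u z}" and l: "0 < l" "l < 1"
    and super: "\<And>x y. u0 x powr l * u1 y powr (1 - l) \<le> u (l * x + (1 - l) * y)"
    and le1: "\<And>z. u0 z \<le> 1" "\<And>z. u1 z \<le> 1"
    and sup1: "\<And>r. r < 1 \<Longrightarrow> \<exists>z. r < u0 z" "\<And>r. r < 1 \<Longrightarrow> \<exists>z. r < u1 z"
  shows "l * (\<integral>z. u0 z \<partial>lborel) + (1 - l) * (\<integral>z. u1 z \<partial>lborel) \<le> (\<integral>z. u z \<partial>lborel)"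
proof -
  note int = integrable_gaussian_bound[OF assms(1) pos(1) bound(1)] integrable_gaussian_bound[OF assms(2) pos(2) bound(2)]
    integrable_gaussian_bound[OF assms(3) pos(3) bound(3)]
  have meas_level [measurable]: "(\<lambda>r. emeasure lborel {z. r < v z}) \<in> borel_measurable borel"
    if [measurable]: "v \<in> borel_measurable borel" for v :: "real \<Rightarrow> real"
  proof -
    have "(\<lambda>r. emeasure lborel {z. r < v z}) \<in> borel_measurable (borel :: real measure)"
      by (rule lborel.measurable_emeasure) measurable
    then show ?thesis .
  qed
  have pt: "ennreal l * (indicator {0<..<1} r * emeasure lborel {z. r < u0 z})
      + ennreal (1 - l) * (indicator {0<..<1} r * emeasure lborel {z. r < u1 z})
      \<le> indicator {0<..<1} r * emeasure lborel {z. r < min (u z) 1}" for r :: real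
  proof (cases "r \<in> {0<..<1}")
    case True
    then have r: "0 < r" "r < 1" by auto
    have eq: "{z. r < min (u z) 1} = {z. r < u z}" using r by auto
    have bd: "bounded {z. r < u0 z}" "bounded {z. r < u1 z}" "bounded {z. r < u z}"
      using bounded_superlevel_gaussian r bound by blast+
    have "l * measure lborel {z. r < u0 z} + (1 - l) * measure lborel {z. r < u1 z} \<le> measure lborel {z. r < u z}"
    proof (rule brunn_minkowski_interval[OF _ _ bd conv _ _ _ l])
      show "{z. r < u0 z} \<noteq> {}" "{z. r < u1 z} \<noteq> {}" using sup1 r by auto
      fix x y assume xy: "x \<in> {z. r < u0 z}" "y \<in> {z. r < u1 z}"
      have "r = r powr l * r powr (1 - l)" using r by (simp flip: powr_add)
      also have "\<dots> < u0 x powr l * u1 y powr (1 - l)"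
        using xy r l by (intro mult_strict_mono powr_less_mono2) auto
      also have "\<dots> \<le> u (l * x + (1 - l) * y)" by (rule super)
      finally show "l * x + (1 - l) * y \<in> {z. r < u z}" by simp
    qed measurable
    moreover have "emeasure lborel {z. r < v z} = ennreal (measure lborel {z. r < v z})"
      if "bounded {z. r < v z}" for v :: "real \<Rightarrow> real"
      using emeasure_bounded_finite[OF that] by (intro emeasure_eq_ennreal_measure) auto
    ultimately show ?thesis
      using True bd l by (simp add: eq ennreal_mult[symmetric] ennreal_plus[symmetric] del: ennreal_plus)
  qed simp
  have "ennreal (l * (\<integral>z. u0 z \<partial>lborel) + (1 - l) * (\<integral>z. u1 z \<partial>lborel))
      = ennreal l * (\<integral>\<^sup>+z. u0 z \<partial>lborel) + ennreal (1 - l) * (\<integral>\<^sup>+z. u1 z \<partial>lborel)"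
    using int pos l by (simp add: nn_integral_eq_integral less_imp_le ennreal_mult ennreal_plus)
  also have "\<dots> = (\<integral>\<^sup>+r. ennreal l * (indicator {0<..<1} r * emeasure lborel {z. r < u0 z})
      + ennreal (1 - l) * (indicator {0<..<1} r * emeasure lborel {z. r < u1 z}) \<partial>lborel)"
    using pos le1 by (subst (1 2) nn_integral_layer_cake_unit) (auto simp: nn_integral_add nn_integral_cmult less_imp_le)
  also have "\<dots> \<le> (\<integral>\<^sup>+r. indicator {0<..<1} r * emeasure lborel {z. r < min (u z) 1} \<partial>lborel)"
    by (rule nn_integral_mono) (rule pt)
  also have "\<dots> = (\<integral>\<^sup>+z. min (u z) 1 \<partial>lborel)"
    using pos by (intro nn_integral_layer_cake_unit[symmetric]) (auto simp: less_imp_le)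
  also have "\<dots> \<le> (\<integral>\<^sup>+z. u z \<partial>lborel)" by (intro nn_integral_mono ennreal_leI) simp
  also have "\<dots> = ennreal (\<integral>z. u z \<partial>lborel)"
    using int pos by (intro nn_integral_eq_integral) (auto simp: less_imp_le)
  finally show ?thesis using int(6) by (simp add: ennreal_le_iff less_imp_le)
qed

text \<open>Dividing \<open>u0\<close> and \<open>u1\<close> by their suprema \<open>a\<close> and
  \<open>b\<close>, and \<open>u\<close> by \<open>a powr l * b powr (1 - l)\<close>, preserves the
  multiplicative hypothesis and reduces to the normalized case. The weighted arithmetic-geometric
  mean inequality then returns to the geometric mean.\<close>

lemma prekopa_leindler_real:
  fixes u0 u1 u :: "real \<Rightarrow> real"
  assumes meas: "u0 \<in> borel_measurable borel" "u1 \<in> borel_measurable borel" "u \<in> borel_measurable borel"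
    and pos: "\<And>z. 0 < u0 z" "\<And>z. 0 < u1 z" "\<And>z. 0 < u z"
    and bound: "\<And>z. u0 z \<le> B * exp (- z\<^sup>2 / 4)" "\<And>z. u1 z \<le> B * exp (- z\<^sup>2 / 4)" "\<And>z. u z \<le> B * exp (- z\<^sup>2 / 4)"
    and conv: "\<And>r. convex {z. r < u z}" and l: "0 < l" "l < 1"
    and super: "\<And>x y. u0 x powr l * u1 y powr (1 - l) \<le> u (l * x + (1 - l) * y)"
  shows "(\<integral>z. u0 z \<partial>lborel) powr l * (\<integral>z. u1 z \<partial>lborel) powr (1 - l) \<le> (\<integral>z. u z \<partial>lborel)"
proof -
  have B: "B > 0" using pos(1)[of 0] bound(1)[of 0] by simp
  have le_B: "v z \<le> B" if "\<And>z. v z \<le> B * exp (- z\<^sup>2 / 4)" for v :: "real \<Rightarrow> real" and z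
    using order_trans[OF that[of z] mult_left_mono[of "exp (- z\<^sup>2 / 4)" 1 B]] B by simp
  have bdd: "bdd_above (range u0)" "bdd_above (range u1)"
    by (rule bdd_aboveI2[of _ _ B], rule le_B[OF bound(1)], rule bdd_aboveI2[of _ _ B], rule le_B[OF bound(2)])
  define a where "a = (SUP z. u0 z)"
  define b where "b = (SUP z. u1 z)"
  have ua: "u0 z \<le> a" and ub: "u1 z \<le> b" for z
    using bdd by (auto simp: a_def b_def intro: cSUP_upper)
  have ab: "a > 0" "b > 0" using ua[of 0] ub[of 0] pos(1)[of 0] pos(2)[of 0] by linarith+
  define m where "m = a powr l * b powr (1 - l)"
  have m: "m > 0" using ab by (simp add: m_def)
  define B' where "B' = max (B / a) (max (B / b) (B / m))"
  have B'_ge: "B / a \<le> B'" "B / b \<le> B'" "B / m \<le> B'" by (auto simp: B'_def)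
  have "l * (\<integral>z. u0 z / a \<partial>lborel) + (1 - l) * (\<integral>z. u1 z / b \<partial>lborel) \<le> (\<integral>z. u z / m \<partial>lborel)"
  proof (rule prekopa_leindler_real_normalized[where B = B'])
    have scale: "v z / k \<le> B' * exp (- z\<^sup>2 / 4)"
      if "\<And>z. v z \<le> B * exp (- z\<^sup>2 / 4)" "k > 0" "B / k \<le> B'" for v :: "real \<Rightarrow> real" and z k
    proof -
      have "v z / k \<le> B * exp (- z\<^sup>2 / 4) / k" using that by (intro divide_right_mono) auto
      also have "\<dots> = (B / k) * exp (- z\<^sup>2 / 4)" by simp
      also have "\<dots> \<le> B' * exp (- z\<^sup>2 / 4)" using that by (intro mult_right_mono) auto
      finally show ?thesis .
    qed
    show "\<And>z. u0 z / a \<le> B' * exp (- z\<^sup>2 / 4)" "\<And>z. u1 z / b \<le> B' * exp (- z\<^sup>2 / 4)"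
      "\<And>z. u z / m \<le> B' * exp (- z\<^sup>2 / 4)"
      using scale bound ab m B'_ge by blast+
    show "convex {z. r < u z / m}" for r
      using conv[of "r * m"] m by (simp add: field_simps)
    fix x y
    have "(u0 x / a) powr l * (u1 y / b) powr (1 - l) = (u0 x powr l * u1 y powr (1 - l)) / m"
      using pos(1)[of x] pos(2)[of y] ab by (simp add: powr_divide m_def)
    also have "\<dots> \<le> u (l * x + (1 - l) * y) / m" using super m by (intro divide_right_mono) auto
    finally show "(u0 x / a) powr l * (u1 y / b) powr (1 - l) \<le> u (l * x + (1 - l) * y) / m" .
  next
    fix r :: real assume r: "r < 1"
    have "r * a < a" "r * b < b" using r ab by auto
    then show "\<exists>z. r < u0 z / a" "\<exists>z. r < u1 z / b"
      using ab bdd unfolding a_def[symmetric] b_def[symmetric]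
      by (auto simp: a_def b_def less_cSUP_iff field_simps)
  qed (use meas pos ab m l ua ub in \<open>auto\<close>)
  then have *: "l * ((\<integral>z. u0 z \<partial>lborel) / a) + (1 - l) * ((\<integral>z. u1 z \<partial>lborel) / b) \<le> (\<integral>z. u z \<partial>lborel) / m"
    by simp
  have ipos: "0 < (\<integral>z. u0 z \<partial>lborel)" "0 < (\<integral>z. u1 z \<partial>lborel)"
    using integrable_gaussian_bound(2)[OF meas(1) pos(1) bound(1)] integrable_gaussian_bound(2)[OF meas(2) pos(2) bound(2)] by auto
  have "(\<integral>z. u0 z \<partial>lborel) powr l * (\<integral>z. u1 z \<partial>lborel) powr (1 - l)
      = m * (((\<integral>z. u0 z \<partial>lborel) / a) powr l * ((\<integral>z. u1 z \<partial>lborel) / b) powr (1 - l))"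
    using ipos ab by (simp add: powr_divide m_def)
  also have "\<dots> \<le> m * (l * ((\<integral>z. u0 z \<partial>lborel) / a) + (1 - l) * ((\<integral>z. u1 z \<partial>lborel) / b))"
    using ipos ab m l by (intro mult_left_mono Youngs_inequality_0) auto
  also have "\<dots> \<le> m * ((\<integral>z. u z \<partial>lborel) / m)" using * m by (intro mult_left_mono) auto
  finally show ?thesis using m by simp
qed

text \<open>The class of integrands is closed under integrating out one coordinate; the parameter \<open>s\<close> takes part
  in the convex combinations, so that the marginal over all coordinates is log-concave in \<open>s\<close>.\<close>

definition gaussian_log_concave :: "'i set \<Rightarrow> (real \<Rightarrow> ('i \<Rightarrow> real) \<Rightarrow> real) \<Rightarrow> bool" where
  "gaussian_log_concave I U \<longleftrightarrow>
     (\<forall>s\<in>{0..1}. U s \<in> borel_measurable (Pi\<^sub>M I (\<lambda>_. lborel))) \<and>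
     (\<exists>B. \<forall>s\<in>{0..1}. \<forall>x\<in>extensional I. 0 < U s x \<and> U s x \<le> B * (\<Prod>i\<in>I. exp (- (x i)\<^sup>2 / 4))) \<and>
     (\<forall>s\<in>{0..1}. \<forall>t\<in>{0..1}. \<forall>l\<in>{0<..<1}. \<forall>x\<in>extensional I. \<forall>y\<in>extensional I.
        U s x powr l * U t y powr (1 - l) \<le> U (l * s + (1 - l) * t) (\<lambda>i. l * x i + (1 - l) * y i))"

lemma gaussian_log_concaveD:
  assumes "gaussian_log_concave I U"
  shows "s \<in> {0..1} \<Longrightarrow> U s \<in> borel_measurable (Pi\<^sub>M I (\<lambda>_. lborel))"
    and "s \<in> {0..1} \<Longrightarrow> x \<in> extensional I \<Longrightarrow> 0 < U s x"
    and "s \<in> {0..1} \<Longrightarrow> t \<in> {0..1} \<Longrightarrow> 0 < l \<Longrightarrow> l < 1 \<Longrightarrow> x \<in> extensional I \<Longrightarrow> y \<in> extensional I \<Longrightarrow>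
        U s x powr l * U t y powr (1 - l) \<le> U (l * s + (1 - l) * t) (\<lambda>i. l * x i + (1 - l) * y i)"
  using assms unfolding gaussian_log_concave_def by auto

lemma gaussian_log_concave_integrable:
  assumes "finite I" "gaussian_log_concave I U" "s \<in> {0..1}"
  shows "integrable (Pi\<^sub>M I (\<lambda>_. lborel)) (U s)"
proof -
  interpret product_sigma_finite "\<lambda>_. lborel :: real measure" by standard
  obtain B where B: "\<And>x. x \<in> extensional I \<Longrightarrow> 0 < U s x \<and> U s x \<le> B * (\<Prod>i\<in>I. exp (- (x i)\<^sup>2 / 4))"
    using assms unfolding gaussian_log_concave_def by blast
  have "integrable (Pi\<^sub>M I (\<lambda>_. lborel)) (\<lambda>x. B * (\<Prod>i\<in>I. exp (- (x i)\<^sup>2 / 4)))"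
    using assms(1) by (intro integrable_mult_right product_integrable_prod integrable_exp_minus_square_div_4)
  then show ?thesis
  proof (rule Bochner_Integration.integrable_bound)
    show "AE x in Pi\<^sub>M I (\<lambda>_. lborel). norm (U s x) \<le> norm (B * (\<Prod>i\<in>I. exp (- (x i)\<^sup>2 / 4)))"
    proof (rule AE_I2)
      fix x assume "x \<in> space (Pi\<^sub>M I (\<lambda>_. lborel :: real measure))"
      then have "x \<in> extensional I" by (simp add: space_PiM PiE_def)
      from B[OF this] show "norm (U s x) \<le> norm (B * (\<Prod>i\<in>I. exp (- (x i)\<^sup>2 / 4)))" by simp
    qed
  qed (rule gaussian_log_concaveD(1)[OF assms(2,3)])
qed

text \<open>For fixed parameters and base points, the slices in the new coordinate \<open>z\<close>
  satisfy the hypotheses of the one-dimensional inequality, whose conclusion is the log-concavity of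
  the marginal. The product envelope integrates to an envelope of the same form.\<close>

lemma gaussian_log_concave_marginal:
  fixes U :: "real \<Rightarrow> ('i \<Rightarrow> real) \<Rightarrow> real"
  assumes I: "finite I" "j \<notin> I" and U: "gaussian_log_concave (insert j I) U"
  shows "gaussian_log_concave I (\<lambda>s x. \<integral>z. U s (x(j := z)) \<partial>lborel)"
proof -
  obtain B where B: "\<And>s x. s \<in> {0..1} \<Longrightarrow> x \<in> extensional (insert j I) \<Longrightarrow>
      0 < U s x \<and> U s x \<le> B * (\<Prod>i\<in>insert j I. exp (- (x i)\<^sup>2 / 4))"
    using U unfolding gaussian_log_concave_def by blast
  have upd_ext: "x(j := z) \<in> extensional (insert j I)" if "x \<in> extensional I" for x and z :: real
    using that by (auto simp: extensional_def)
  have B': "U s (x(j := z)) \<le> (B * (\<Prod>i\<in>I. exp (- (x i)\<^sup>2 / 4))) * exp (- z\<^sup>2 / 4)"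
    if "s \<in> {0..1}" "x \<in> extensional I" for s x z
  proof -
    have "(\<Prod>i\<in>I. exp (- ((x(j := z)) i)\<^sup>2 / 4)) = (\<Prod>i\<in>I. exp (- (x i)\<^sup>2 / 4))"
      using I by (intro prod.cong) auto
    then show ?thesis using B[OF that(1) upd_ext[OF that(2)], of z] I by (simp add: mult_ac)
  qed
  have pos: "0 < U s (x(j := z))" if "s \<in> {0..1}" "x \<in> extensional I" for s x z
    using B[OF that(1) upd_ext[OF that(2)]] by blast
  have U_joint: "(\<lambda>(x, z). U s (x(j := z))) \<in> borel_measurable (Pi\<^sub>M I (\<lambda>_. lborel) \<Otimes>\<^sub>M lborel)"
    if "s \<in> {0..1}" for s
    using measurable_compose[OF measurable_add_dim gaussian_log_concaveD(1)[OF U that]]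
    by (simp add: split_def)
  have slice: "(\<lambda>z. U s (x(j := z))) \<in> borel_measurable borel" if "s \<in> {0..1}" "x \<in> extensional I" for s x
    using measurable_Pair2[OF U_joint[OF that(1)], of x] that(2) by (simp add: space_PiM PiE_def)
  note int = integrable_gaussian_bound[OF slice pos B']
  show ?thesis
    unfolding gaussian_log_concave_def
  proof (intro conjI ballI)
    fix s :: real assume s: "s \<in> {0..1}"
    show "(\<lambda>x. \<integral>z. U s (x(j := z)) \<partial>lborel) \<in> borel_measurable (Pi\<^sub>M I (\<lambda>_. lborel))"
      using U_joint[OF s] by (intro lborel.borel_measurable_lebesgue_integral) auto
  next
    show "\<exists>B. \<forall>s\<in>{0..1}. \<forall>x\<in>extensional I. 0 < (\<integral>z. U s (x(j := z)) \<partial>lborel) \<and>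
        (\<integral>z. U s (x(j := z)) \<partial>lborel) \<le> B * (\<Prod>i\<in>I. exp (- (x i)\<^sup>2 / 4))"
    proof (intro exI ballI conjI)
      fix s :: real and x :: "'i \<Rightarrow> real" assume sx: "s \<in> {0..1}" "x \<in> extensional I"
      show "0 < (\<integral>z. U s (x(j := z)) \<partial>lborel)" using int(2) sx by blast
      have "(\<integral>z. U s (x(j := z)) \<partial>lborel) \<le> (\<integral>z. (B * (\<Prod>i\<in>I. exp (- (x i)\<^sup>2 / 4))) * exp (- z\<^sup>2 / 4) \<partial>lborel)"
        using int(1) sx B'[OF sx] by (intro integral_mono integrable_mult_right integrable_exp_minus_square_div_4) auto
      then show "(\<integral>z. U s (x(j := z)) \<partial>lborel)
          \<le> (B * (\<integral>z. exp (- z\<^sup>2 / 4) \<partial>lborel)) * (\<Prod>i\<in>I. exp (- (x i)\<^sup>2 / 4))"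
        by (simp add: mult_ac)
    qed
  next
    fix s t l :: real and x y :: "'i \<Rightarrow> real"
    assume st: "s \<in> {0..1}" "t \<in> {0..1}" and l: "l \<in> {0<..<1}" and xy: "x \<in> extensional I" "y \<in> extensional I"
    let ?s = "l * s + (1 - l) * t" and ?x = "\<lambda>i. l * x i + (1 - l) * y i"
    have s': "?s \<in> {0..1}"
      using st l convexD_alt[of "{0..1::real}" t s l] by (simp add: algebra_simps)
    have comb: "(\<lambda>i. k * x i + (1 - k) * y i) \<in> extensional I"
      if "x \<in> extensional I" "y \<in> extensional I" for x y :: "'i \<Rightarrow> real" and k
      using that by (auto simp: extensional_def algebra_simps)
    have x': "?x \<in> extensional I" using comb xy by blast
    have upd: "(\<lambda>i. l * (x(j := z)) i + (1 - l) * (y(j := z')) i) = (\<lambda>i. l * x i + (1 - l) * y i)(j := l * z + (1 - l) * z')"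
      for l :: real and x y :: "'i \<Rightarrow> real" and z z' by auto
    have lc: "U s (x(j := z)) powr k * U t (y(j := z')) powr (1 - k)
        \<le> U (k * s + (1 - k) * t) ((\<lambda>i. k * x i + (1 - k) * y i)(j := k * z + (1 - k) * z'))"
      if "s \<in> {0..1}" "t \<in> {0..1}" "0 < k" "k < 1" "x \<in> extensional I" "y \<in> extensional I" for s t k x y z z'
      using gaussian_log_concaveD(3)[OF U that(1-4) upd_ext[OF that(5), of z] upd_ext[OF that(6), of z']]
      unfolding upd .
    \<comment> \<open>The one-dimensional inequality asks for one constant serving all three
      slices.\<close>
    define B2 where "B2 = max (B * (\<Prod>i\<in>I. exp (- (x i)\<^sup>2 / 4)))
       (max (B * (\<Prod>i\<in>I. exp (- (y i)\<^sup>2 / 4))) (B * (\<Prod>i\<in>I. exp (- (?x i)\<^sup>2 / 4))))"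
    have B2: "U r (v(j := z)) \<le> B2 * exp (- z\<^sup>2 / 4)"
      if "r \<in> {0..1}" "v \<in> extensional I" "B * (\<Prod>i\<in>I. exp (- (v i)\<^sup>2 / 4)) \<le> B2" for r v z
      by (rule order_trans[OF B'[OF that(1,2)] mult_right_mono[OF that(3)]]) simp
    show "(\<integral>z. U s (x(j := z)) \<partial>lborel) powr l * (\<integral>z. U t (y(j := z)) \<partial>lborel) powr (1 - l)
        \<le> (\<integral>z. U ?s (?x(j := z)) \<partial>lborel)"
    proof (rule prekopa_leindler_real[where B = B2])
      show "convex {z. r < U ?s (?x(j := z))}" for r
      proof (cases "r \<ge> 0")
        case False
        then have "{z. r < U ?s (?x(j := z))} = UNIV"
          using pos[OF s' x'] by (auto intro: less_trans simp: not_le)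
        then show ?thesis by simp
      next
        case True
        show ?thesis
        proof (rule convexI)
          fix z z' u v :: real
          assume z: "z \<in> {z. r < U ?s (?x(j := z))}" "z' \<in> {z. r < U ?s (?x(j := z))}"
            and uv: "0 \<le> u" "0 \<le> v" "u + v = 1"
          show "u *\<^sub>R z + v *\<^sub>R z' \<in> {z. r < U ?s (?x(j := z))}"
          proof (cases "u = 0 \<or> v = 0")
            case True then show ?thesis using z uv by auto
          next
            case False
            then have u: "0 < u" "u < 1" and v: "v = 1 - u" using uv by auto
            have "r = r powr u * r powr (1 - u)" using \<open>r \<ge> 0\<close> by (simp flip: powr_add)
            also have "\<dots> < U ?s (?x(j := z)) powr u * U ?s (?x(j := z')) powr (1 - u)"
              using z u \<open>r \<ge> 0\<close> by (intro mult_strict_mono powr_less_mono2) auto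
            \<comment> \<open>Log-concavity with both parameters equal to \<open>?s\<close> and both
              base points equal to \<open>?x\<close> makes the middle slice log-concave in
              \<open>z\<close> alone, hence its superlevel sets convex.\<close>
            also have "\<dots> \<le> U (u * ?s + (1 - u) * ?s) ((\<lambda>i. u * ?x i + (1 - u) * ?x i)(j := u * z + (1 - u) * z'))"
              by (rule lc[OF s' s' u x' x'])
            also have "u * ?s + (1 - u) * ?s = ?s" by (simp add: algebra_simps)
            also have "(\<lambda>i. u * ?x i + (1 - u) * ?x i) = ?x" by (rule ext) (simp add: algebra_simps)
            finally show ?thesis by (simp add: v fun_upd_def)
          qed
        qed
      qed
    next
      show "U s (x(j := z)) powr l * U t (y(j := z')) powr (1 - l) \<le> U ?s (?x(j := l * z + (1 - l) * z'))" for z z'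
        using l by (intro lc st xy) auto
    next
      show "0 < l" "l < 1" using l by auto
      show "U s (x(j := z)) \<le> B2 * exp (- z\<^sup>2 / 4)" for z
        by (rule B2[OF st(1) xy(1)]) (simp add: B2_def)
      show "U t (y(j := z)) \<le> B2 * exp (- z\<^sup>2 / 4)" for z
        by (rule B2[OF st(2) xy(2)]) (simp add: B2_def)
      show "U ?s (?x(j := z)) \<le> B2 * exp (- z\<^sup>2 / 4)" for z
        by (rule B2[OF s' x']) (simp add: B2_def)
    qed (rule slice pos st xy s' x')+
  qed
qed

lemma prekopa_PiM:
  assumes "finite I" "gaussian_log_concave I U" "s \<in> {0..1}" "t \<in> {0..1}" "0 < l" "l < 1"
  shows "(\<integral>x. U s x \<partial>Pi\<^sub>M I (\<lambda>_. lborel)) powr l * (\<integral>x. U t x \<partial>Pi\<^sub>M I (\<lambda>_. lborel)) powr (1 - l)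
    \<le> (\<integral>x. U (l * s + (1 - l) * t) x \<partial>Pi\<^sub>M I (\<lambda>_. lborel))"
  using assms
proof (induction I arbitrary: U rule: finite_induct)
  case empty
  \<comment> \<open>The only member of \<open>extensional {}\<close> is the function with constant
    value \<open>undefined\<close>; as a real number it is fixed by the convex combination, so the
    log-concavity condition is already the claim.\<close>
  have undef: "l * undefined + (1 - l) * undefined = (undefined :: real)"
    by (simp add: algebra_simps)
  show ?case
    using gaussian_log_concaveD(3)[OF empty(1-5), of "\<lambda>_. undefined" "\<lambda>_. undefined", unfolded undef]
    by (simp add: PiM_empty lebesgue_integral_count_space_finite)
next
  case (insert j I)
  interpret product_sigma_finite "\<lambda>_. lborel :: real measure" by standard
  have s': "l * s + (1 - l) * t \<in> {0..1}"
    using insert.prems convexD_alt[of "{0..1::real}" t s l] by (simp add: algebra_simps)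
  have fub: "(\<integral>x. U r x \<partial>Pi\<^sub>M (insert j I) (\<lambda>_. lborel)) = (\<integral>x. (\<integral>z. U r (x(j := z)) \<partial>lborel) \<partial>Pi\<^sub>M I (\<lambda>_. lborel))"
    if "r \<in> {0..1}" for r
    using insert that by (intro product_integral_insert gaussian_log_concave_integrable) auto
  show ?case
    unfolding fub[OF insert.prems(2)] fub[OF insert.prems(3)] fub[OF s']
    by (rule insert.IH[OF gaussian_log_concave_marginal]) (use insert in auto)
qed

text \<open>Transport along the coordinate map \<open>V\<close>, under which \<open>lborel\<close>
  is the image of the product measure and the squared norm becomes a sum of squares, so that the
  envelope factorises.\<close>

lemma prekopa_lborel:
  fixes F :: "real \<Rightarrow> 'a::euclidean_space \<Rightarrow> real"
  assumes meas: "\<And>s. s \<in> {0..1} \<Longrightarrow> F s \<in> borel_measurable borel"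
    and pos: "\<And>s x. s \<in> {0..1} \<Longrightarrow> 0 < F s x"
    and bound: "\<And>s x. s \<in> {0..1} \<Longrightarrow> F s x \<le> B * exp (- (norm x)\<^sup>2 / 4)"
    and lc: "\<And>s t l x y. s \<in> {0..1} \<Longrightarrow> t \<in> {0..1} \<Longrightarrow> 0 < l \<Longrightarrow> l < 1
      \<Longrightarrow> F s x powr l * F t y powr (1 - l) \<le> F (l * s + (1 - l) * t) (l *\<^sub>R x + (1 - l) *\<^sub>R y)"
    and st: "s \<in> {0..1}" "t \<in> {0..1}" and l: "0 < l" "l < 1"
  shows "(\<integral>x. F s x \<partial>lborel) powr l * (\<integral>x. F t x \<partial>lborel) powr (1 - l)
    \<le> (\<integral>x. F (l * s + (1 - l) * t) x \<partial>lborel)"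
proof -
  define V :: "('a \<Rightarrow> real) \<Rightarrow> 'a" where "V = (\<lambda>x. \<Sum>b\<in>Basis. x b *\<^sub>R b)"
  have V [measurable]: "V \<in> measurable (Pi\<^sub>M Basis (\<lambda>_. lborel)) borel"
    unfolding V_def by measurable
  have V_inner: "V x \<bullet> b = x b" if "b \<in> Basis" for x b
    using that by (simp add: V_def)
  have V_norm: "(norm (V x))\<^sup>2 = (\<Sum>b\<in>Basis. (x b)\<^sup>2)" for x
    unfolding power2_norm_eq_inner by (subst euclidean_inner) (simp add: V_inner power2_eq_square)
  have V_lin: "V (\<lambda>i. k * x i + m * y i) = k *\<^sub>R V x + m *\<^sub>R V y" for x y k m
    by (simp add: V_def scaleR_left_distrib sum.distrib scaleR_sum_right)
  have s': "l * s + (1 - l) * t \<in> {0..1}"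
    using st l convexD_alt[of "{0..1::real}" t s l] by (simp add: algebra_simps)
  have "gaussian_log_concave (Basis :: 'a set) (\<lambda>s x. F s (V x))"
    unfolding gaussian_log_concave_def
  proof (intro conjI exI[of _ B] ballI)
    fix s :: real and x :: "'a \<Rightarrow> real" assume s: "s \<in> {0..1}"
    have "exp (- (norm (V x))\<^sup>2 / 4) = (\<Prod>i\<in>Basis. exp (- (x i)\<^sup>2 / 4))"
      by (simp add: V_norm exp_sum[symmetric] sum_divide_distrib sum_negf)
    then show "F s (V x) \<le> B * (\<Prod>i\<in>Basis. exp (- (x i)\<^sup>2 / 4))"
      using bound[OF s, of "V x"] by simp
  qed (use meas pos lc in \<open>auto simp: V_lin\<close>)
  from prekopa_PiM[OF _ this st l] show ?thesis
    using meas st s' by (simp add: lborel_eq[where 'a='a] V_def[symmetric] integral_distr)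
qed

section \<open>Vitale's inequality for the Wills functional\<close>


lemma exp_minus_norm_square:
  "exp (- (norm (x::'a::euclidean_space))\<^sup>2 / k) = (\<Prod>b\<in>Basis. exp (- (x \<bullet> b)\<^sup>2 / k))"
  unfolding power2_norm_eq_inner euclidean_inner[of x x]
  by (simp add: exp_sum[symmetric] sum_divide_distrib sum_negf power2_eq_square)

lemma integrable_exp_minus_norm_square_div_4:
  "integrable lborel (\<lambda>x::'a::euclidean_space. exp (- (norm x)\<^sup>2 / 4))"
proof (rule integrableI_bounded)
  have "(\<integral>\<^sup>+x. ennreal (norm (exp (- (norm (x::'a))\<^sup>2 / 4))) \<partial>lborel)
      = (\<integral>\<^sup>+x. (\<Prod>b\<in>Basis. ennreal (exp (- ((x::'a) \<bullet> b)\<^sup>2 / 4))) \<partial>lborel)"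
    unfolding exp_minus_norm_square by (intro nn_integral_cong) (simp add: prod_ennreal prod_nonneg)
  also have "\<dots> = (\<Prod>b\<in>(Basis::'a set). \<integral>\<^sup>+z. ennreal (exp (- z\<^sup>2 / 4)) \<partial>lborel)"
    by (rule nn_integral_lborel_prod) auto
  also have "\<dots> < \<infinity>"
    using integrable_exp_minus_square_div_4 by (simp add: integrable_iff_bounded less_top[symmetric] power_eq_top_ennreal)
  finally show "(\<integral>\<^sup>+x. ennreal (norm (exp (- (norm (x::'a))\<^sup>2 / 4))) \<partial>lborel) < \<infinity>" .
qed simp

lemma gaussian_integral:
  defines "\<kappa> \<equiv> (2 * pi) powr (- real DIM('a::euclidean_space) / 2)"
  shows "integrable lborel (\<lambda>x::'a. \<kappa> * exp (- (norm x)\<^sup>2 / 2))"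
    and "(\<integral>x. \<kappa> * exp (- (norm (x::'a))\<^sup>2 / 2) \<partial>lborel) = 1"
proof -
  have k: "\<kappa> = (1 / sqrt (2 * pi)) ^ DIM('a)"
  proof -
    have "\<kappa> = ((2 * pi) powr (- 1 / 2)) powr real DIM('a)"
      unfolding \<kappa>_def powr_powr by simp
    also have "\<dots> = (1 / sqrt (2 * pi)) ^ DIM('a)"
      by (subst powr_realpow) (auto simp: powr_minus_divide powr_half_sqrt)
    finally show ?thesis .
  qed
  have prod: "\<kappa> * exp (- (norm x)\<^sup>2 / 2) = (\<Prod>b\<in>Basis. std_normal_density (x \<bullet> b))" for x :: 'a
    unfolding exp_minus_norm_square k std_normal_density_def prod.distrib by simp
  have "(\<integral>\<^sup>+x. ennreal (\<kappa> * exp (- (norm (x::'a))\<^sup>2 / 2)) \<partial>lborel)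
      = (\<integral>\<^sup>+x. (\<Prod>b\<in>Basis. ennreal (std_normal_density ((x::'a) \<bullet> b))) \<partial>lborel)"
    unfolding prod by (simp add: prod_ennreal)
  also have "\<dots> = (\<Prod>b\<in>(Basis::'a set). \<integral>\<^sup>+z. ennreal (std_normal_density z) \<partial>lborel)"
    by (rule nn_integral_lborel_prod) auto
  also have "\<dots> = 1"
    by (simp add: nn_integral_eq_integral integrable_normal_density integral_normal_density)
  finally have *: "(\<integral>\<^sup>+x. ennreal (\<kappa> * exp (- (norm (x::'a))\<^sup>2 / 2)) \<partial>lborel) = ennreal 1" by simp
  have "has_bochner_integral lborel (\<lambda>x::'a. \<kappa> * exp (- (norm x)\<^sup>2 / 2)) 1"
    by (rule has_bochner_integral_nn_integral[OF _ _ _ *]) (auto simp: \<kappa>_def)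
  then show "integrable lborel (\<lambda>x::'a. \<kappa> * exp (- (norm x)\<^sup>2 / 2))"
    and "(\<integral>x. \<kappa> * exp (- (norm (x::'a))\<^sup>2 / 2) \<partial>lborel) = 1"
    by (auto simp: has_bochner_integral_iff)
qed

text \<open>Lagrange's form of the remainder. The factor beside \<open>l\<^sup>2\<close> is
  independent of \<open>l\<close>, so after integration it is a single constant for all
  \<open>l\<close> in the unit interval.\<close>

lemma exp_le_quadratic_remainder:
  fixes a l :: real
  assumes "0 \<le> l" "l \<le> 1"
  shows "exp (l * a) \<le> 1 + l * a + l\<^sup>2 * (a\<^sup>2 * exp \<bar>a\<bar>)"
proof -
  obtain t where t: "\<bar>t\<bar> \<le> \<bar>l * a\<bar>" "exp (l * a) = (\<Sum>m<2. (l * a) ^ m / fact m) + exp t / fact 2 * (l * a) ^ 2"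
    using Maclaurin_exp_le by blast
  have "\<bar>l * a\<bar> \<le> \<bar>a\<bar>" using assms by (simp add: abs_mult mult_left_le_one_le)
  then have "exp t / 2 \<le> exp \<bar>a\<bar>" using t(1) exp_gt_zero[of t] exp_le_cancel_iff[of t "\<bar>a\<bar>"] by linarith
  then have "exp t / 2 * (l * a)\<^sup>2 \<le> exp \<bar>a\<bar> * (l * a)\<^sup>2"
    by (intro mult_right_mono) auto
  then show ?thesis using t(2) by (simp add: eval_nat_numeral power_mult_distrib mult_ac)
qed

text \<open>If \<open>s *\<^sub>R c\<close> and \<open>t *\<^sub>R d\<close> are nearest points,
  their convex combination lies in the set scaled by \<open>r = l * s + (1 - l) * t\<close>, because
  c and d enter with weights \<open>l * s / r\<close> and \<open>(1 - l) * t / r\<close>, which sum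
  to 1. Convexity of the norm gives the rest.\<close>

lemma infdist_scaled_convex:
  fixes C :: "'a::euclidean_space set"
  assumes C: "compact C" "convex C" "C \<noteq> {}" and s: "0 \<le> s" and t: "0 \<le> t" and l: "0 < l" "l < 1"
  shows "infdist (l *\<^sub>R x + (1 - l) *\<^sub>R y) ((*\<^sub>R) (l * s + (1 - l) * t) ` C)
    \<le> l * infdist x ((*\<^sub>R) s ` C) + (1 - l) * infdist y ((*\<^sub>R) t ` C)"
proof -
  have cl: "closed ((*\<^sub>R) r ` C)" "(*\<^sub>R) r ` C \<noteq> {}" for r
    using C by (auto intro!: compact_imp_closed compact_scaling)
  obtain c where c: "c \<in> C" "infdist x ((*\<^sub>R) s ` C) = dist x (s *\<^sub>R c)"
    using infdist_attains_inf[OF cl(1)[of s] cl(2)[of s], of x] by blast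
  obtain d where d: "d \<in> C" "infdist y ((*\<^sub>R) t ` C) = dist y (t *\<^sub>R d)"
    using infdist_attains_inf[OF cl(1)[of t] cl(2)[of t], of y] by blast
  define r where "r = l * s + (1 - l) * t"
  obtain e where e: "e \<in> C" "r *\<^sub>R e = l *\<^sub>R s *\<^sub>R c + (1 - l) *\<^sub>R t *\<^sub>R d"
  proof (cases "r = 0")
    case True
    have "0 \<le> l * s" "0 \<le> (1 - l) * t" using s t l by auto
    then have "l * s = 0" "(1 - l) * t = 0" using True unfolding r_def by linarith+
    then show ?thesis using c(1) True by (intro that[of c]) auto
  next
    case False
    moreover have "0 \<le> l * s" "0 \<le> (1 - l) * t" using s t l by auto
    ultimately have r: "r > 0" unfolding r_def by linarith
    have "(l * s / r) *\<^sub>R c + ((1 - l) * t / r) *\<^sub>R d \<in> C"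
      using C(2) c(1) d(1) r \<open>0 \<le> l * s\<close> \<open>0 \<le> (1 - l) * t\<close>
      by (intro convexD) (auto simp: add_divide_distrib[symmetric] r_def)
    then show ?thesis using r by (intro that) (auto simp: scaleR_add_right)
  qed
  have "infdist (l *\<^sub>R x + (1 - l) *\<^sub>R y) ((*\<^sub>R) r ` C) \<le> dist (l *\<^sub>R x + (1 - l) *\<^sub>R y) (r *\<^sub>R e)"
    using e(1) by (intro infdist_le) auto
  also have "\<dots> = norm (l *\<^sub>R (x - s *\<^sub>R c) + (1 - l) *\<^sub>R (y - t *\<^sub>R d))"
    unfolding e(2) dist_norm by (simp add: algebra_simps)
  also have "\<dots> \<le> norm (l *\<^sub>R (x - s *\<^sub>R c)) + norm ((1 - l) *\<^sub>R (y - t *\<^sub>R d))"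
    by (rule norm_triangle_ineq)
  also have "\<dots> = l * infdist x ((*\<^sub>R) s ` C) + (1 - l) * infdist y ((*\<^sub>R) t ` C)"
    using l by (simp add: c(2) d(2) dist_norm)
  finally show ?thesis by (simp add: r_def)
qed

text \<open>This is Vitale's inequality \<open>log W(C) \<le> V\<^sub>1(C)\<close> for the Wills functional
  \<open>W\<close>: by Prekopa's theorem \<open>s \<mapsto> log W(s C)\<close> is concave, it vanishes at \<open>s = 0\<close>,
  and its slope there is at most the Gaussian width.\<close>

lemma integral_exp_infdist_le_exp_width:
  fixes C :: "'a::euclidean_space set" and h :: "'a \<Rightarrow> real"
  defines "\<kappa> \<equiv> (2 * pi) powr (- real DIM('a) / 2)"
  assumes C: "compact C" "convex C" "C \<noteq> {}" and R: "\<And>c. c \<in> C \<Longrightarrow> norm c \<le> R"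
    and h [measurable]: "h \<in> borel_measurable borel" and hC: "\<And>x c. c \<in> C \<Longrightarrow> x \<bullet> c \<le> h x"
    and h_abs: "\<And>x. \<bar>h x\<bar> \<le> R * norm x"
  shows "integrable lborel (\<lambda>x. \<kappa> * exp (- (infdist x C)\<^sup>2 / 2))"
    and "(\<integral>x. \<kappa> * exp (- (infdist x C)\<^sup>2 / 2) \<partial>lborel) \<le> exp (\<integral>x. h x * (\<kappa> * exp (- (norm x)\<^sup>2 / 2)) \<partial>lborel)"
proof -
  have \<kappa>: "\<kappa> > 0" by (simp add: \<kappa>_def)
  note gauss = gaussian_integral[where 'a='a, folded \<kappa>_def]
  have R0: "R \<ge> 0" using C(3) R norm_ge_zero order_trans by (metis all_not_in_conv)
  \<comment> \<open>The integrand of the Wills functional of the scaled body, up to the constant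
    \<open>\<kappa>\<close>: \<open>s = 0\<close> gives the Gaussian itself and \<open>s = 1\<close>
    the integrand in the claim.\<close>
  define F where "F s x = exp (- (infdist x ((*\<^sub>R) s ` C))\<^sup>2 / 2)" for s x
  have F_meas [measurable]: "F s \<in> borel_measurable borel" for s
    unfolding F_def by (intro borel_measurable_continuous_onI continuous_intros) auto
  have cl: "closed ((*\<^sub>R) r ` C)" "(*\<^sub>R) r ` C \<noteq> {}" for r
    using C by (auto intro!: compact_imp_closed compact_scaling)
  have attained: "\<exists>c\<in>C. infdist x ((*\<^sub>R) s ` C) = norm (x - s *\<^sub>R c)" for x s
    using infdist_attains_inf[OF cl(1)[of s] cl(2)[of s], of x] by (auto simp: dist_norm)
  have F_bound: "F s x \<le> exp (R\<^sup>2 / 2) * exp (- (norm x)\<^sup>2 / 4)" if s: "s \<in> {0..1}" for s x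
  proof -
    obtain c where c: "c \<in> C" "infdist x ((*\<^sub>R) s ` C) = norm (x - s *\<^sub>R c)" using attained by blast
    have "norm (s *\<^sub>R c) \<le> 1 * R" using s R[OF c(1)] unfolding norm_scaleR by (intro mult_mono) auto
    then have d: "norm x - R \<le> infdist x ((*\<^sub>R) s ` C)"
      using norm_triangle_ineq2[of x "s *\<^sub>R c"] by (simp add: c(2))
    have "(norm x)\<^sup>2 / 4 \<le> (infdist x ((*\<^sub>R) s ` C))\<^sup>2 / 2 + R\<^sup>2 / 2"
    proof (cases "norm x \<le> R")
      case True
      then have "(norm x)\<^sup>2 \<le> R\<^sup>2" by (intro power_mono) auto
      then show ?thesis
        using zero_le_power2[of "infdist x ((*\<^sub>R) s ` C)"] zero_le_power2[of R] by linarith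
    next
      case False
      then have "(norm x - R)\<^sup>2 \<le> (infdist x ((*\<^sub>R) s ` C))\<^sup>2" using d by (intro power_mono) auto
      moreover have "(norm x)\<^sup>2 / 4 \<le> (norm x - R)\<^sup>2 / 2 + R\<^sup>2 / 2"
        using zero_le_power2[of "norm x / 2 - R"] by (simp add: power2_eq_square field_simps)
      ultimately show ?thesis by simp
    qed
    then show ?thesis by (simp add: F_def exp_add[symmetric])
  qed
  have F_int: "integrable lborel (F s)" if "s \<in> {0..1}" for s
  proof (rule Bochner_Integration.integrable_bound[OF integrable_mult_right[OF integrable_exp_minus_norm_square_div_4, of "exp (R\<^sup>2 / 2)"]])
    show "AE x in lborel. norm (F s x) \<le> norm (exp (R\<^sup>2 / 2) * exp (- (norm x)\<^sup>2 / 4))"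
    proof (rule AE_I2)
      fix x show "norm (F s x) \<le> norm (exp (R\<^sup>2 / 2) * exp (- (norm x)\<^sup>2 / 4))"
        using F_bound[OF that, of x] by (simp add: F_def)
    qed
  qed measurable
  have F1: "F 1 x = exp (- (infdist x C)\<^sup>2 / 2)" for x by (simp add: F_def)
  show int1: "integrable lborel (\<lambda>x. \<kappa> * exp (- (infdist x C)\<^sup>2 / 2))"
    using integrable_mult_right[OF F_int[of 1], of \<kappa>] by (simp add: F1)
  have F0: "F 0 x = exp (- (norm x)\<^sup>2 / 2)" for x
  proof -
    have "(*\<^sub>R) 0 ` C = {0}" using C(3) by auto
    then show ?thesis by (simp add: F_def infdist_singleton)
  qed
  define D where "D = (\<integral>x. h x * (\<kappa> * exp (- (norm x)\<^sup>2 / 2)) \<partial>lborel)"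
  define E where "E = (\<integral>x. ((h x)\<^sup>2 * exp \<bar>h x\<bar>) * (\<kappa> * exp (- (norm x)\<^sup>2 / 2)) \<partial>lborel)"
  \<comment> \<open>This growth condition covers both \<open>h\<close> and the quadratic remainder
    \<open>(h x)\<^sup>2 * exp \<bar>h x\<bar>\<close>. Since 2 R |x| \<le> 4 R^2 + |x|^2/4, the
    Gaussian absorbs it and still decays at rate 1/4.\<close>
  have dominated: "integrable lborel (\<lambda>x. k x * (\<kappa> * exp (- (norm x)\<^sup>2 / 2)))"
    if [measurable]: "k \<in> borel_measurable borel" and k: "\<And>x. \<bar>k x\<bar> \<le> 2 * exp (2 * \<bar>h x\<bar>)" for k :: "'a \<Rightarrow> real"
  proof (rule Bochner_Integration.integrable_bound[OF integrable_mult_right[OF integrable_exp_minus_norm_square_div_4, of "2 * \<kappa> * exp (4 * R\<^sup>2)"]])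
    have "\<bar>k x\<bar> * (\<kappa> * exp (- (norm x)\<^sup>2 / 2)) \<le> 2 * \<kappa> * exp (4 * R\<^sup>2) * exp (- (norm x)\<^sup>2 / 4)" for x
    proof -
      have "2 * (R * norm x) \<le> 4 * R\<^sup>2 + (norm x)\<^sup>2 / 4"
        using zero_le_power2[of "2 * R - norm x / 2"] by (simp add: power2_eq_square algebra_simps)
      then have "2 * \<bar>h x\<bar> \<le> 4 * R\<^sup>2 + (norm x)\<^sup>2 / 4" using h_abs[of x] by linarith
      then have "\<bar>k x\<bar> \<le> 2 * exp (4 * R\<^sup>2 + (norm x)\<^sup>2 / 4)"
        by (intro order_trans[OF k]) simp
      then have "\<bar>k x\<bar> * (\<kappa> * exp (- (norm x)\<^sup>2 / 2)) \<le> 2 * exp (4 * R\<^sup>2 + (norm x)\<^sup>2 / 4) * (\<kappa> * exp (- (norm x)\<^sup>2 / 2))"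
        using \<kappa> by (intro mult_right_mono) auto
      also have "\<dots> = 2 * \<kappa> * (exp (4 * R\<^sup>2 + (norm x)\<^sup>2 / 4) * exp (- (norm x)\<^sup>2 / 2))" by simp
      also have "exp (4 * R\<^sup>2 + (norm x)\<^sup>2 / 4) * exp (- (norm x)\<^sup>2 / 2) = exp (4 * R\<^sup>2) * exp (- (norm x)\<^sup>2 / 4)"
        by (simp add: exp_add[symmetric])
      finally show ?thesis by (simp add: mult_ac)
    qed
    then show "AE x in lborel. norm (k x * (\<kappa> * exp (- (norm x)\<^sup>2 / 2))) \<le> norm (2 * \<kappa> * exp (4 * R\<^sup>2) * exp (- (norm x)\<^sup>2 / 4))"
      using \<kappa> by (auto simp: abs_mult intro!: AE_I2)
  qed simp
  have exp_lin: "a \<le> exp a" for a :: real using exp_ge_add_one_self[of a] by linarith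
  have D_int: "integrable lborel (\<lambda>x. h x * (\<kappa> * exp (- (norm x)\<^sup>2 / 2)))"
  proof (rule dominated[OF h])
    fix x show "\<bar>h x\<bar> \<le> 2 * exp (2 * \<bar>h x\<bar>)"
      using exp_lin[of "2 * \<bar>h x\<bar>"] by linarith
  qed
  have E_int: "integrable lborel (\<lambda>x. ((h x)\<^sup>2 * exp \<bar>h x\<bar>) * (\<kappa> * exp (- (norm x)\<^sup>2 / 2)))"
  proof (rule dominated)
    fix x
    have "(h x)\<^sup>2 \<le> 2 * exp \<bar>h x\<bar>"
      using exp_lower_Taylor_quadratic[of "\<bar>h x\<bar>"] by simp
    then have "(h x)\<^sup>2 * exp \<bar>h x\<bar> \<le> 2 * exp \<bar>h x\<bar> * exp \<bar>h x\<bar>" by (intro mult_right_mono) auto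
    also have "\<dots> = 2 * exp (2 * \<bar>h x\<bar>)" by (simp add: exp_add[symmetric])
    finally show "\<bar>(h x)\<^sup>2 * exp \<bar>h x\<bar>\<bar> \<le> 2 * exp (2 * \<bar>h x\<bar>)" by (simp add: abs_mult)
  qed measurable
  have E0: "E \<ge> 0" unfolding E_def using \<kappa> by (intro Bochner_Integration.integral_nonneg) auto
  define W where "W s = \<kappa> * (\<integral>x. F s x \<partial>lborel)" for s
  have W0: "W 0 = 1" using gauss by (simp add: W_def F0)
  have W_upper: "W l \<le> 1 + l * D + l\<^sup>2 * E" if l: "0 < l" "l < 1" for l
  proof -
    have pt: "\<kappa> * F l x \<le> \<kappa> * exp (- (norm x)\<^sup>2 / 2) + l * (h x * (\<kappa> * exp (- (norm x)\<^sup>2 / 2)))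
        + l\<^sup>2 * ((h x)\<^sup>2 * exp \<bar>h x\<bar> * (\<kappa> * exp (- (norm x)\<^sup>2 / 2)))" for x
    proof -
      obtain c where c: "c \<in> C" "infdist x ((*\<^sub>R) l ` C) = norm (x - l *\<^sub>R c)" using attained by blast
      have "(norm (x - l *\<^sub>R c))\<^sup>2 = (norm x)\<^sup>2 - 2 * l * (x \<bullet> c) + l\<^sup>2 * (norm c)\<^sup>2"
        unfolding power2_norm_eq_inner by (simp add: algebra_simps inner_commute power2_eq_square)
      moreover have "l * (x \<bullet> c) \<le> l * h x" using hC[OF c(1)] l by (intro mult_left_mono) auto
      moreover have "0 \<le> l\<^sup>2 * (norm c)\<^sup>2" by simp
      \<comment> \<open>The term with |c|^2 is discarded because it has a favourable sign; what
        remains is linear in \<open>l\<close>, with slope at most \<open>h x\<close>.\<close>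
      ultimately have "- (norm (x - l *\<^sub>R c))\<^sup>2 / 2 \<le> l * h x + (- (norm x)\<^sup>2 / 2)" by linarith
      then have "F l x \<le> exp (l * h x) * exp (- (norm x)\<^sup>2 / 2)"
        unfolding F_def c(2) exp_add[symmetric] by simp
      also have "\<dots> \<le> (1 + l * h x + l\<^sup>2 * ((h x)\<^sup>2 * exp \<bar>h x\<bar>)) * exp (- (norm x)\<^sup>2 / 2)"
        using l by (intro mult_right_mono exp_le_quadratic_remainder) auto
      finally have "\<kappa> * F l x \<le> \<kappa> * ((1 + l * h x + l\<^sup>2 * ((h x)\<^sup>2 * exp \<bar>h x\<bar>)) * exp (- (norm x)\<^sup>2 / 2))"
        using \<kappa> by (intro mult_left_mono) auto
      then show ?thesis by (simp add: algebra_simps)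
    qed
    have "W l = (\<integral>x. \<kappa> * F l x \<partial>lborel)" by (simp add: W_def)
    also have "\<dots> \<le> (\<integral>x. \<kappa> * exp (- (norm x)\<^sup>2 / 2) + l * (h x * (\<kappa> * exp (- (norm x)\<^sup>2 / 2)))
        + l\<^sup>2 * ((h x)\<^sup>2 * exp \<bar>h x\<bar> * (\<kappa> * exp (- (norm x)\<^sup>2 / 2))) \<partial>lborel)"
      using F_int[of l] l gauss D_int E_int pt
      by (intro integral_mono integrable_mult_right Bochner_Integration.integrable_add) auto
    also have "\<dots> = 1 + l * D + l\<^sup>2 * E"
      unfolding D_def E_def using gauss D_int E_int
      by (simp only: Bochner_Integration.integral_add Bochner_Integration.integrable_add
          integrable_mult_right integral_mult_right_zero)
    finally show ?thesis .
  qed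
  have W1_pos: "W 1 > 0"
  proof -
    have F_pos: "F 1 x > 0" for x by (simp add: F_def)
    then have "0 \<le> (\<integral>x. F 1 x \<partial>lborel)" by (intro Bochner_Integration.integral_nonneg) (simp add: less_imp_le)
    moreover have "(\<integral>x. F 1 x \<partial>lborel) \<noteq> 0"
    proof
      assume "(\<integral>x. F 1 x \<partial>lborel) = 0"
      then have "AE x in lborel. F 1 x = 0"
        using integral_nonneg_eq_0_iff_AE[OF F_int[of 1]] F_pos by (simp add: less_imp_le)
      then have "AE x in (lborel :: 'a measure). False" using F_pos by (simp add: less_le)
      then show False by (simp add: eventually_False ae_filter_eq_bot_iff)
    qed
    ultimately show ?thesis using \<kappa> by (simp add: W_def)
  qed
  \<comment> \<open>Log-concavity between the parameters 1 and 0, where \<open>W 0 = 1\<close> drops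
    out; the powers of \<open>\<kappa>\<close> combine to one factor since the exponents sum to
    1.\<close>
  have W_lower: "W 1 powr l \<le> W l" if l: "0 < l" "l < 1" for l
  proof -
    have "(\<integral>x. F 1 x \<partial>lborel) powr l * (\<integral>x. F 0 x \<partial>lborel) powr (1 - l) \<le> (\<integral>x. F (l * 1 + (1 - l) * 0) x \<partial>lborel)"
    proof (rule prekopa_lborel[OF F_meas _ F_bound])
      fix s t l :: real and x y :: 'a
      assume st: "s \<in> {0..1}" "t \<in> {0..1}" and l: "0 < l" "l < 1"
      let ?a = "infdist x ((*\<^sub>R) s ` C)" and ?b = "infdist y ((*\<^sub>R) t ` C)"
        and ?c = "infdist (l *\<^sub>R x + (1 - l) *\<^sub>R y) ((*\<^sub>R) (l * s + (1 - l) * t) ` C)"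
      have "?c \<le> l * ?a + (1 - l) * ?b" using st l by (intro infdist_scaled_convex[OF C]) auto
      then have "?c\<^sup>2 \<le> (l * ?a + (1 - l) * ?b)\<^sup>2" by (intro power_mono) (auto simp: infdist_nonneg)
      also have "\<dots> = l * ?a\<^sup>2 + (1 - l) * ?b\<^sup>2 - l * (1 - l) * (?a - ?b)\<^sup>2"
        by (simp add: power2_eq_square algebra_simps)
      also have "\<dots> \<le> l * ?a\<^sup>2 + (1 - l) * ?b\<^sup>2" using l by simp
      finally have "?c\<^sup>2 \<le> l * ?a\<^sup>2 + (1 - l) * ?b\<^sup>2" .
      then show "F s x powr l * F t y powr (1 - l) \<le> F (l * s + (1 - l) * t) (l *\<^sub>R x + (1 - l) *\<^sub>R y)"
        unfolding F_def by (simp add: powr_def exp_add[symmetric] field_simps)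
    qed (use l in \<open>auto simp: F_def\<close>)
    then have *: "(\<integral>x. F 1 x \<partial>lborel) powr l * (\<integral>x. F 0 x \<partial>lborel) powr (1 - l) \<le> (\<integral>x. F l x \<partial>lborel)"
      by simp
    have i1: "(\<integral>x. F 1 x \<partial>lborel) = W 1 / \<kappa>" and i0: "(\<integral>x. F 0 x \<partial>lborel) = 1 / \<kappa>"
      using \<kappa> W0 by (auto simp: W_def field_simps)
    have "W 1 powr l / \<kappa> = (W 1 / \<kappa>) powr l * (1 / \<kappa>) powr (1 - l)"
      using \<kappa> W1_pos by (simp add: powr_divide powr_add[symmetric])
    also have "\<dots> \<le> W l / \<kappa>" using * \<kappa> unfolding i1 i0 by (simp add: W_def)
    finally show ?thesis using \<kappa> by (simp add: divide_le_cancel)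
  qed
  have "ln (W 1) \<le> D"
  proof (rule field_le_epsilon)
    fix e :: real assume e: "e > 0"
    \<comment> \<open>Comparing \<open>W_lower\<close> with \<open>W_upper\<close> and dividing by
      \<open>l\<close> leaves the error \<open>l * E\<close>, which this choice makes at most
      \<open>e\<close>. The denominator \<open>E + 1\<close> covers the case
      \<open>E = 0\<close>.\<close>
    define l where "l = min (1 / 2) (e / (E + 1))"
    have l: "0 < l" "l < 1" using e E0 by (auto simp: l_def)
    have "l * E \<le> e / (E + 1) * (E + 1)" using e E0 by (intro mult_mono) (auto simp: l_def)
    then have lE: "l * E \<le> e" using E0 by simp
    have "exp (l * ln (W 1)) \<le> 1 + (l * D + l\<^sup>2 * E)"
      using W_lower[OF l] W_upper[OF l] W1_pos by (simp add: powr_def)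
    also have "\<dots> \<le> exp (l * D + l\<^sup>2 * E)" by (rule exp_ge_add_one_self)
    finally have "l * ln (W 1) \<le> l * (D + l * E)" by (simp add: algebra_simps power2_eq_square)
    then show "ln (W 1) \<le> D + e" using l lE by simp
  qed
  then have "W 1 \<le> exp D" using W1_pos by (metis exp_le_cancel_iff exp_ln)
  then show "(\<integral>x. \<kappa> * exp (- (infdist x C)\<^sup>2 / 2) \<partial>lborel) \<le> exp (\<integral>x. h x * (\<kappa> * exp (- (norm x)\<^sup>2 / 2)) \<partial>lborel)"
    by (simp add: W_def D_def F1)
qed

section \<open>The reverse logarithmic Sobolev inequality\<close>


lemma has_field_derivative_pos_part_square:
  fixes s :: real
  shows "((\<lambda>s. (max 0 s)\<^sup>2) has_field_derivative 2 * max 0 s) (at s)"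
proof (cases s "0 :: real" rule: linorder_cases)
  case less
  have "((\<lambda>s. 0) has_field_derivative 0) (at s)" by simp
  then have "((\<lambda>s. (max 0 s)\<^sup>2) has_field_derivative 0) (at s)"
    by (rule has_field_derivative_transform_within_open[of _ _ _ "{..<0}"]) (use less in auto)
  then show ?thesis using less by simp
next
  case equal
  have "((\<lambda>y::real. (max 0 y)\<^sup>2 / y) \<longlongrightarrow> 0) (at 0)"
  proof (rule Lim_null_comparison)
    show "\<forall>\<^sub>F y in at 0. norm ((max 0 y)\<^sup>2 / y) \<le> \<bar>y\<bar>" for y :: real
      by (intro always_eventually allI) (auto simp: max_def power2_eq_square)
    show "((\<lambda>y::real. \<bar>y\<bar>) \<longlongrightarrow> 0) (at 0)" by (intro tendsto_eq_intros) auto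
  qed
  then show ?thesis using equal by (simp add: has_field_derivative_iff)
next
  case greater
  have "((\<lambda>s. s\<^sup>2) has_field_derivative 2 * s) (at s)" by (auto intro!: derivative_eq_intros)
  then have "((\<lambda>s. (max 0 s)\<^sup>2) has_field_derivative 2 * s) (at s)"
    by (rule has_field_derivative_transform_within_open[of _ _ _ "{0<..}"]) (use greater in auto)
  then show ?thesis using greater by simp
qed

text \<open>Squaring the positive part removes the kink on the sphere of radius \<open>r\<close>. A
  derivative at every point is what the bisection argument requires, and this bump has one in closed
  form.\<close>

definition cutoff :: "real \<Rightarrow> 'a::real_inner \<Rightarrow> real" where
  "cutoff r x = (max 0 (1 - (norm x)\<^sup>2 / r\<^sup>2))\<^sup>2"

lemma cutoff_has_derivative:
  fixes x :: "'a::real_inner"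
  shows "(cutoff r has_derivative (\<lambda>h. - 4 * max 0 (1 - (norm x)\<^sup>2 / r\<^sup>2) * (x \<bullet> h) / r\<^sup>2)) (at x)"
proof -
  have "((\<lambda>x::'a. 1 - 1 / r\<^sup>2 * (x \<bullet> x)) has_derivative (\<lambda>h. - 2 * (1 / r\<^sup>2) * (x \<bullet> h))) (at x)"
    by (rule derivative_eq_intros refl)+ (simp add: inner_commute algebra_simps)
  then have "((\<lambda>x::'a. 1 - (norm x)\<^sup>2 / r\<^sup>2) has_derivative (\<lambda>h. - 2 * (x \<bullet> h) / r\<^sup>2)) (at x)"
    by (simp add: power2_norm_eq_inner)
  from has_derivative_compose[OF this has_field_derivative_pos_part_square[unfolded has_field_derivative_def]]
  show ?thesis unfolding cutoff_def by (rule has_derivative_eq_rhs) (simp add: fun_eq_iff)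
qed

lemma cutoff_bounds: "0 \<le> cutoff r x" "cutoff r x \<le> 1"
  unfolding cutoff_def by (auto intro!: power_le_one)

lemma abs_cutoff_mult_le: "\<bar>cutoff r x * c\<bar> \<le> \<bar>c\<bar>"
  by (simp add: abs_mult abs_of_nonneg[OF cutoff_bounds(1)] mult_left_le_one_le cutoff_bounds)

lemma cutoff_eq_0:
  assumes "0 < r" "r \<le> norm x"
  shows "max 0 (1 - (norm x)\<^sup>2 / r\<^sup>2) = 0" "cutoff r x = 0"
proof -
  have "r\<^sup>2 \<le> (norm x)\<^sup>2" using assms by (intro power_mono) auto
  then have "1 \<le> (norm x)\<^sup>2 / r\<^sup>2" using assms by (simp add: field_simps)
  then show "max 0 (1 - (norm x)\<^sup>2 / r\<^sup>2) = 0" "cutoff r x = 0" by (auto simp: cutoff_def)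
qed

lemma tendsto_cutoff: "(\<lambda>n. cutoff (real (Suc n)) x) \<longlonglongrightarrow> 1"
proof -
  have "(\<lambda>n. 1 / real (Suc n)) \<longlonglongrightarrow> 0"
    using LIMSEQ_inverse_real_of_nat by (simp add: inverse_eq_divide)
  then have "(\<lambda>n. (max 0 (1 - (norm x)\<^sup>2 * (1 / real (Suc n))\<^sup>2))\<^sup>2) \<longlonglongrightarrow> (max 0 (1 - (norm x)\<^sup>2 * 0\<^sup>2))\<^sup>2"
    by (intro tendsto_intros)
  then show ?thesis by (simp add: cutoff_def power_divide)
qed

lemma integrable_compact_support:
  fixes g :: "'a::euclidean_space \<Rightarrow> real"
  assumes "continuous_on UNIV g" "\<And>x. r \<le> norm x \<Longrightarrow> g x = 0"
  shows "integrable lborel g"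
proof -
  have "integrable lborel (\<lambda>x. indicator (cball 0 r) x *\<^sub>R g x)"
    using assms(1) by (intro borel_integrable_compact) (auto intro: continuous_on_subset)
  also have "(\<lambda>x. indicator (cball 0 r) x *\<^sub>R g x) = g"
    using assms(2) by (auto simp: indicator_def fun_eq_iff)
  finally show ?thesis .
qed

text \<open>The field is \<eta> p v with \<eta> the cutoff. As \<nabla>p = p (v - x), its divergence
  is \<eta> p (div v + |v|^2 - x\<bullet>v) + p v\<bullet>\<nabla>\<eta>. Replacing div v by its
  lower bound \<open>- M\<close> yields \<open>g\<close>, which is continuous even if div v is
  not.\<close>

lemma weighted_divergence_cutoff:
  fixes f :: "'a::euclidean_space \<Rightarrow> real" and v :: "'a \<Rightarrow> 'a"
  assumes f': "\<And>x. (f has_derivative (\<lambda>h. h \<bullet> v x)) (at x)" and v': "\<And>x. (v has_derivative v' x) (at x)"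
    and lap: "\<And>x. - M \<le> (\<Sum>b\<in>Basis. v' x b \<bullet> b)" and r: "r > 0" and \<kappa>: "\<kappa> > 0"
  defines "p \<equiv> \<lambda>x. \<kappa> * exp (f x - (norm x)\<^sup>2 / 2)"
  defines "g \<equiv> \<lambda>x. cutoff r x * p x * ((norm (v x))\<^sup>2 - x \<bullet> v x - M)
      - 4 * max 0 (1 - (norm x)\<^sup>2 / r\<^sup>2) * (x \<bullet> v x) / r\<^sup>2 * p x"
  shows "integrable lborel g" "(\<integral>x. g x \<partial>lborel) \<le> 0"
proof -
  have cont_f: "continuous_on UNIV f" and cont_v: "continuous_on UNIV v"
    using f' v' has_derivative_continuous by (metis continuous_at_imp_continuous_on)+
  have cont: "continuous_on UNIV g"
    unfolding g_def p_def cutoff_def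
    by (intro continuous_intros cont_f cont_v) (use r in auto)
  have supp: "g x = 0" if "r \<le> norm x" for x
    using cutoff_eq_0[OF r that] by (simp add: g_def)
  show "integrable lborel g" using cont supp by (rule integrable_compact_support)
  have p': "(p has_derivative (\<lambda>h. p x * (h \<bullet> v x - x \<bullet> h))) (at x)" for x
    unfolding p_def power2_norm_eq_inner
    by (auto intro!: derivative_eq_intros f' simp: fun_eq_iff inner_commute algebra_simps)
  define q where "q x = cutoff r x * p x" for x
  define q' where "q' x h = cutoff r x * (p x * (h \<bullet> v x - x \<bullet> h))
      + - 4 * max 0 (1 - (norm x)\<^sup>2 / r\<^sup>2) * (x \<bullet> h) / r\<^sup>2 * p x" for x h
  have q_deriv: "(q has_derivative q' x) (at x)" for x
    unfolding q_def q'_def by (rule has_derivative_mult[OF cutoff_has_derivative p'])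
  have w_deriv: "((\<lambda>x. q x *\<^sub>R v x) has_derivative (\<lambda>h. q x *\<^sub>R v' x h + q' x h *\<^sub>R v x)) (at x)" for x
    by (rule has_derivative_scaleR[OF q_deriv v'])
  show "(\<integral>x. g x \<partial>lborel) \<le> 0"
  proof (rule integral_nonpos_of_compact_support_divergence[OF w_deriv cont _ _ supp r])
    fix x
    interpret q': bounded_linear "q' x" using q_deriv by (rule has_derivative_bounded_linear)
    have "q' x (v x) = q' x (\<Sum>b\<in>Basis. (v x \<bullet> b) *\<^sub>R b)" by (simp add: euclidean_representation)
    also have "\<dots> = (\<Sum>b\<in>Basis. q' x b * (v x \<bullet> b))" by (simp add: q'.sum q'.scaleR mult.commute)
    finally have "(\<Sum>b\<in>Basis. (q x *\<^sub>R v' x b + q' x b *\<^sub>R v x) \<bullet> b) = q x * (\<Sum>b\<in>Basis. v' x b \<bullet> b) + q' x (v x)"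
      by (simp add: inner_add_left sum.distrib sum_distrib_left)
    moreover have "q x \<ge> 0" using cutoff_bounds(1)[of r x] \<kappa> by (simp add: q_def p_def)
    then have "q x * (- M) \<le> q x * (\<Sum>b\<in>Basis. v' x b \<bullet> b)" using lap by (intro mult_left_mono)
    moreover have "g x = q x * (- M) + q' x (v x)"
      by (simp add: g_def q_def q'_def power2_norm_eq_inner algebra_simps)
    ultimately show "g x \<le> (\<Sum>b\<in>Basis. (q x *\<^sub>R v' x b + q' x b *\<^sub>R v x) \<bullet> b)" by simp
  next
    fix x :: 'a assume "r \<le> norm x"
    then show "q x *\<^sub>R v x = 0" using cutoff_eq_0(2)[OF r, of x] by (simp add: q_def)
  qed
qed

section \<open>Boundedness of the gradient set and the Laplacian as a trace\<close>

lemma closure_eq_UNIV_of_AE: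
  fixes S :: "'a::euclidean_space set"
  assumes "AE x in lborel. x \<in> S"
  shows "closure S = UNIV"
proof (rule ccontr)
  assume "closure S \<noteq> UNIV"
  then have "\<not> negligible (- closure S)" by (intro open_not_negligible) auto
  moreover have "AE x in lborel. x \<notin> - closure S"
    using assms by (rule AE_mp) (auto intro!: AE_I2 simp: closure_subset[THEN subsetD])
  then have "- closure S \<in> null_sets lborel" by (subst AE_iff_null_sets) auto
  then have "negligible (- closure S)"
    by (simp add: negligible_iff_null_sets null_sets_completionI)
  ultimately show False by blast
qed

text \<open>The directions in which \<open>K\<close> is bounded above form a convex set of full
  measure, hence a dense one. A convex set has the same interior as its closure, so every direction
  occurs; the basis vectors and their negatives then bound each coordinate.\<close>

lemma bounded_of_support_function_finite:
  fixes K :: "(real ^ 'n) set"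
  assumes "K \<noteq> {}" and fin: "AE y in lborel. \<bar>support_function K y\<bar> \<noteq> \<infinity>"
  shows "bounded K"
proof -
  define S where "S = {y. bdd_above ((\<lambda>t. y \<bullet> t) ` K)}"
  have in_S: "y \<in> S" if y: "\<bar>support_function K y\<bar> \<noteq> \<infinity>" for y
  proof -
    obtain r where r: "support_function K y = ereal r" using y by auto
    have "ereal (y \<bullet> t) \<le> ereal r" if "t \<in> K" for t
      using that unfolding r[symmetric] support_function_def by (rule SUP_upper)
    then show ?thesis unfolding S_def by (auto intro!: bdd_aboveI2[of _ _ r])
  qed
  have "AE y in lborel. y \<in> S" using fin by (rule AE_mp) (auto intro!: AE_I2 in_S)
  then have "closure S = UNIV" by (rule closure_eq_UNIV_of_AE)
  moreover have "convex S"
  proof (rule convexI)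
    fix x y u v assume xy: "x \<in> S" "y \<in> S" and uv: "0 \<le> u" "0 \<le> v" "u + v = (1::real)"
    obtain a where a: "\<And>t. t \<in> K \<Longrightarrow> x \<bullet> t \<le> a" using xy(1) by (auto simp: S_def bdd_above_def)
    obtain b where b: "\<And>t. t \<in> K \<Longrightarrow> y \<bullet> t \<le> b" using xy(2) by (auto simp: S_def bdd_above_def)
    have "(u *\<^sub>R x + v *\<^sub>R y) \<bullet> t \<le> u * a + v * b" if "t \<in> K" for t
      unfolding inner_add_left inner_scaleR_left
      using a[OF that] b[OF that] uv by (intro add_mono mult_left_mono)
    then show "u *\<^sub>R x + v *\<^sub>R y \<in> S" unfolding S_def by (auto intro!: bdd_aboveI2)
  qed
  ultimately have "S = UNIV" using convex_interior_closure[of S] interior_subset[of S] by auto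
  then have "\<forall>y. \<exists>B. \<forall>t\<in>K. y \<bullet> t \<le> B" by (auto simp: S_def bdd_above_def)
  then obtain \<beta> where \<beta>: "\<And>y t. t \<in> K \<Longrightarrow> y \<bullet> t \<le> \<beta> y" by metis
  show "bounded K"
  proof (rule boundedI)
    fix t assume t: "t \<in> K"
    have "norm t \<le> (\<Sum>b\<in>Basis. \<bar>t \<bullet> b\<bar>)" by (rule norm_le_l1)
    also have "\<dots> \<le> (\<Sum>b\<in>Basis. max (\<beta> b) (\<beta> (- b)))"
    proof (rule sum_mono)
      fix b :: "real ^ 'n"
      show "\<bar>t \<bullet> b\<bar> \<le> max (\<beta> b) (\<beta> (- b))"
        using \<beta>[OF t, of b] \<beta>[OF t, of "- b"] by (auto simp: inner_commute abs_le_iff le_max_iff_disj)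
    qed
    finally show "norm t \<le> (\<Sum>b\<in>Basis. max (\<beta> b) (\<beta> (- b)))" .
  qed
qed

text \<open>Identifies the iterated one-variable derivatives with the divergence of the gradient
  field, the form in which the lower bound on the Laplacian enters the divergence
  inequality.\<close>

lemma laplacian_eq_trace:
  fixes f :: "real ^ 'n \<Rightarrow> real"
  assumes f: "\<And>x. f differentiable (at x)" and v': "(gradient f has_derivative v') (at x)"
  shows "laplacian f x = (\<Sum>b\<in>Basis. v' b \<bullet> b)"
proof -
  have "partial_derivative i (partial_derivative i f) x = v' (axis i 1) \<bullet> axis i 1" for i
  proof -
    have grad: "partial_derivative i f = (\<lambda>y. gradient f y \<bullet> axis i 1)"
      using gradient_nth[OF f] by (simp add: fun_eq_iff cart_eq_inner_axis)
    interpret v': bounded_linear v' using v' by (rule has_derivative_bounded_linear)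
    have "(gradient f has_derivative v') (at (x + 0 *\<^sub>R axis i 1))" using v' by simp
    moreover have "((\<lambda>t. x + t *\<^sub>R axis i 1) has_derivative (\<lambda>t. t *\<^sub>R axis i 1)) (at (0::real))"
      by (auto intro!: derivative_eq_intros)
    ultimately have "((\<lambda>t. gradient f (x + t *\<^sub>R axis i 1)) has_derivative (\<lambda>t. v' (t *\<^sub>R axis i 1))) (at 0)"
      by (rule has_derivative_compose[rotated])
    then have "((\<lambda>t. gradient f (x + t *\<^sub>R axis i 1) \<bullet> axis i 1) has_derivative (\<lambda>t. v' (t *\<^sub>R axis i 1) \<bullet> axis i 1)) (at 0)"
      by (rule has_derivative_inner_left)
    then have "((\<lambda>t. gradient f (x + t *\<^sub>R axis i 1) \<bullet> axis i 1) has_field_derivative v' (axis i 1) \<bullet> axis i 1) (at 0)"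
      unfolding has_field_derivative_def
      by (rule has_derivative_eq_rhs) (simp add: v'.scaleR fun_eq_iff mult.commute)
    then show ?thesis unfolding grad partial_derivative_def by (rule DERIV_imp_deriv)
  qed
  moreover have "(\<Sum>b\<in>(Basis :: (real ^ 'n) set). v' b \<bullet> b) = (\<Sum>i\<in>UNIV. v' (axis i 1) \<bullet> axis i 1)"
  proof -
    have basis: "(Basis :: (real ^ 'n) set) = (\<lambda>i. axis i 1) ` UNIV" by (auto simp: Basis_vec_def)
    have "inj (\<lambda>i::'n. axis i (1::real))" by (auto simp: inj_def axis_eq_axis)
    then show ?thesis unfolding basis by (subst sum.reindex) simp_all
  qed
  ultimately show ?thesis by (simp add: laplacian_def)
qed

theorem theorem1:
  fixes f :: "real ^ 'n \<Rightarrow> real"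
    and \<nu> :: "(real ^ 'n) measure"
    and K :: "(real ^ 'n) set"
    and M :: real
  assumes f: "twice_differentiable f"
    and \<nu>: "\<nu> = density std_gaussian (\<lambda>x. ennreal (exp (f x)))"
    and prob: "prob_space \<nu>"
    and entropy_finite: "integrable \<nu> f"
    and fisher_finite: "integrable \<nu> (\<lambda>x. (norm (gradient f x))\<^sup>2)"
    and K: "K = range (gradient f)"
    and width_finite: "support_function_integrable K"
    and M_finite: "bdd_below (range (laplacian f))"
    and M: "M = - (INF x. laplacian f x)"
  shows "1 / 2 * fisher_information \<nu> f
           \<le> KL_divergence (exp 1) std_gaussian \<nu> + M + gaussian_width K"
proof -
  define v where "v = gradient f"
  define \<kappa> :: real where "\<kappa> = (2 * pi) powr (- real DIM(real ^ 'n) / 2)"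
  have \<kappa>: "\<kappa> > 0" by (simp add: \<kappa>_def)
  define p where "p x = \<kappa> * exp (f x - (norm x)\<^sup>2 / 2)" for x
  have f_diff: "f differentiable (at x)" and v_diff: "v differentiable (at x)" for x
    using f by (auto simp: twice_differentiable_def v_def)
  have f': "(f has_derivative (\<lambda>h. h \<bullet> v x)) (at x)" for x
    using GDERIV_gradient[OF f_diff] by (simp add: gderiv_def v_def)
  obtain v' where v': "\<And>x. (v has_derivative v' x) (at x)"
    using v_diff unfolding differentiable_def by metis
  have lap: "- M \<le> (\<Sum>b\<in>Basis. v' x b \<bullet> b)" for x
    using cINF_lower[OF M_finite, of x] laplacian_eq_trace[OF f_diff v'[unfolded v_def], of x] by (simp add: M)
  have [measurable]: "f \<in> borel_measurable borel" "v \<in> borel_measurable borel"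
    by (rule borel_measurable_continuous_onI[OF has_derivative_continuous_on], rule f',
        rule borel_measurable_continuous_onI[OF has_derivative_continuous_on], rule v')
  have std: "std_gaussian = density lborel (\<lambda>x :: real ^ 'n. ennreal (\<kappa> * exp (- (norm x)\<^sup>2 / 2)))"
    by (simp add: std_gaussian_def \<kappa>_def)
  have \<nu>_lborel: "\<nu> = density lborel (\<lambda>x. ennreal (p x))"
  proof -
    have "ennreal (\<kappa> * exp (- (norm x)\<^sup>2 / 2)) * ennreal (exp (f x)) = ennreal (p x)" for x
    proof -
      have "exp (- (norm x)\<^sup>2 / 2) * exp (f x) = exp (f x - (norm x)\<^sup>2 / 2)"
        by (simp add: exp_add[symmetric])
      then show ?thesis using \<kappa> by (simp add: p_def ennreal_mult[symmetric] mult.assoc)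
    qed
    then show ?thesis unfolding \<nu> std by (subst density_density_eq) auto
  qed
  have p_pos: "p x > 0" for x using \<kappa> by (simp add: p_def)
  have [measurable]: "p \<in> borel_measurable borel" unfolding p_def by measurable
  have int_iff: "integrable \<nu> F \<longleftrightarrow> integrable lborel (\<lambda>x. p x * F x)"
    if [measurable]: "F \<in> borel_measurable borel" for F :: "real ^ 'n \<Rightarrow> real"
    unfolding \<nu>_lborel using p_pos by (subst integrable_real_density) (auto simp: less_imp_le)
  have int_eq: "(\<integral>x. F x \<partial>\<nu>) = (\<integral>x. p x * F x \<partial>lborel)"
    if [measurable]: "F \<in> borel_measurable borel" for F :: "real ^ 'n \<Rightarrow> real"
    unfolding \<nu>_lborel using p_pos by (subst integral_real_density) (auto simp: less_imp_le)
  interpret \<nu>: prob_space \<nu> by (rule prob)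
  have p_int: "integrable lborel p" and p_one: "(\<integral>x. p x \<partial>lborel) = 1"
    using int_iff[of "\<lambda>_. 1"] int_eq[of "\<lambda>_. 1"] \<nu>.prob_space by auto
  have pf_int: "integrable lborel (\<lambda>x. p x * f x)" using int_iff entropy_finite by simp
  have pv_int: "integrable lborel (\<lambda>x. p x * (norm (v x))\<^sup>2)"
    using fisher_finite by (subst int_iff[symmetric]) (simp_all add: v_def[symmetric])
  have K_ne: "K \<noteq> {}" by (simp add: K)
  \<comment> \<open>The Gaussian density is positive, so Gaussian and Lebesgue null sets
    agree.\<close>
  have fin: "AE y in lborel. \<bar>support_function K y\<bar> \<noteq> \<infinity>"
    using width_finite \<kappa> unfolding support_function_integrable_def std by (simp add: AE_density)
  then have "bounded K" by (rule bounded_of_support_function_finite[OF K_ne])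
  then obtain R where R: "\<And>t. t \<in> K \<Longrightarrow> norm t \<le> R" by (auto simp: bounded_iff)
  define h where "h x = (SUP t\<in>K. x \<bullet> t)" for x
  have inner_le: "\<bar>x \<bullet> t\<bar> \<le> R * norm x" if "t \<in> K" for x t
    using Cauchy_Schwarz_ineq2[of x t] mult_right_mono[OF R[OF that], of "norm x"] by (simp add: mult.commute)
  have bdd: "bdd_above ((\<lambda>t. x \<bullet> t) ` K)" for x
    using inner_le by (intro bdd_aboveI2[of _ _ "R * norm x"]) (meson abs_le_D1)
  have h_upper: "x \<bullet> t \<le> h x" if "t \<in> K" for x t
    unfolding h_def using that bdd by (intro cSUP_upper)
  have h_abs: "\<bar>h x\<bar> \<le> R * norm x" for x
  proof -
    have "h x \<le> R * norm x"
      unfolding h_def using K_ne inner_le by (intro cSUP_least) (auto simp: abs_le_iff)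
    moreover obtain t where "t \<in> K" using K_ne by blast
    then have "- (R * norm x) \<le> h x" using h_upper[of t x] inner_le[of t x] by linarith
    ultimately show ?thesis by (simp add: abs_le_iff)
  qed
  have supp_h: "support_function K x = ereal (h x)" for x
  proof -
    have "support_function K x \<le> ereal (h x)"
      unfolding support_function_def using h_upper by (intro SUP_least) auto
    moreover obtain t where t: "t \<in> K" using K_ne by blast
    have "ereal (x \<bullet> t) \<le> support_function K x"
      unfolding support_function_def using t by (rule SUP_upper)
    ultimately have "\<bar>support_function K x\<bar> \<noteq> \<infinity>" by auto
    then show ?thesis unfolding support_function_def h_def by (simp add: ereal_SUP)
  qed
  \<comment> \<open>\<open>K\<close> may be uncountable, so measurability of the supremum is read
    off from the integrability hypothesis.\<close>
  have h_meas [measurable]: "h \<in> borel_measurable borel"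
    using width_finite borel_measurable_integrable[of std_gaussian h]
    by (simp add: support_function_integrable_def supp_h std)
  define C where "C = closure (convex hull K)"
  have C_sub: "C \<subseteq> T" if "K \<subseteq> T" "convex T" "closed T" for T
    unfolding C_def using that by (intro closure_minimal hull_minimal)
  have C: "compact C" "convex C" "C \<noteq> {}"
    using \<open>bounded K\<close> K_ne unfolding C_def
    by (auto simp: compact_eq_bounded_closed bounded_convex_hull convex_closure)
  have vC: "v x \<in> C" for x
    using hull_subset[of K convex] closure_subset[of "convex hull K"] by (auto simp: C_def K v_def)
  have C_R: "norm c \<le> R" if "c \<in> C" for c
  proof -
    have "K \<subseteq> cball 0 R" using R by auto
    then have "C \<subseteq> cball 0 R" by (rule C_sub) auto
    then show ?thesis using that by auto
  qed
  have C_h: "x \<bullet> c \<le> h x" if "c \<in> C" for x c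
  proof -
    have "K \<subseteq> {t. x \<bullet> t \<le> h x}" using h_upper by auto
    then have "C \<subseteq> {t. x \<bullet> t \<le> h x}" by (rule C_sub) (auto simp: convex_halfspace_le closed_halfspace_le)
    then show ?thesis using that by auto
  qed
  define D where "D = gaussian_width K"
  have D: "D = (\<integral>x. h x * (\<kappa> * exp (- (norm x)\<^sup>2 / 2)) \<partial>lborel)"
    unfolding D_def gaussian_width_def supp_h std using \<kappa>
    by (subst integral_real_density) (auto simp: mult.commute)
  \<comment> \<open>This is exp \<phi> times the Gaussian density; its integral is the Wills
    functional of \<open>C\<close>.\<close>
  define \<psi> where "\<psi> x = \<kappa> * exp (- (infdist x C)\<^sup>2 / 2)" for x
  have \<psi>_int: "integrable lborel \<psi>" and \<psi>_le: "(\<integral>x. \<psi> x \<partial>lborel) \<le> exp D"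
    using integral_exp_infdist_le_exp_width[OF C C_R h_meas C_h h_abs] unfolding \<psi>_def D \<kappa>_def by auto
  \<comment> \<open>With t = \<phi> - f - D, the inequality p (1 + t) \<le> p exp t = exp(-D) \<psi>
    bounds p \<phi> by p f + (D - 1) p + exp(-D) \<psi>. Inserting this in p (|v|^2 - x\<bullet>v -
    M) leaves \<open>G\<close>, a minorant built from integrable terms only. The \<open>- 1\<close>
    is balanced at the end by the integral of exp(-D) \<psi>, which is at most 1.\<close>
  define G where "G x = p x * (norm (v x))\<^sup>2 / 2 - p x * f x - (M + D - 1) * p x - exp (- D) * \<psi> x" for x
  have G_int: "integrable lborel G"
    unfolding G_def using pv_int pf_int p_int \<psi>_int
    by (intro Bochner_Integration.integrable_diff integrable_mult_right integrable_divide)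
  have G_le: "G x \<le> p x * ((norm (v x))\<^sup>2 - x \<bullet> v x - M)" for x
  proof -
    define d where "d = infdist x C"
    have "d\<^sup>2 \<le> (norm (x - v x))\<^sup>2"
      unfolding d_def using infdist_le[OF vC, of x x] by (intro power_mono) (auto simp: dist_norm infdist_nonneg)
    also have "\<dots> = (norm x)\<^sup>2 - 2 * (x \<bullet> v x) + (norm (v x))\<^sup>2"
      unfolding power2_norm_eq_inner by (simp add: inner_commute algebra_simps)
    finally have 1: "x \<bullet> v x \<le> (norm (v x))\<^sup>2 / 2 + ((norm x)\<^sup>2 / 2 - d\<^sup>2 / 2)" by simp
    have "p x * (1 + ((norm x)\<^sup>2 / 2 - d\<^sup>2 / 2 - f x - D)) \<le> p x * exp ((norm x)\<^sup>2 / 2 - d\<^sup>2 / 2 - f x - D)"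
      using p_pos[of x] by (intro mult_left_mono exp_ge_add_one_self) simp
    also have "\<dots> = exp (- D) * \<psi> x"
      by (simp add: p_def \<psi>_def d_def mult.assoc mult.left_commute exp_add[symmetric])
    finally have "p x * (1 + ((norm x)\<^sup>2 / 2 - d\<^sup>2 / 2 - f x - D)) \<le> exp (- D) * \<psi> x" .
    moreover have "p x * (x \<bullet> v x) \<le> p x * ((norm (v x))\<^sup>2 / 2 + ((norm x)\<^sup>2 / 2 - d\<^sup>2 / 2))"
      using 1 p_pos[of x] by (intro mult_left_mono) auto
    ultimately show ?thesis by (simp add: G_def algebra_simps)
  qed
  \<comment> \<open>The gradient of the cutoff has size at most \<open>4 / r\<close>, so a finite
    first moment of |v| makes its contribution vanish as \<open>r\<close> grows.\<close>
  have pv1_int: "integrable lborel (\<lambda>x. p x * norm (v x))"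
  proof (rule Bochner_Integration.integrable_bound[OF Bochner_Integration.integrable_add[OF p_int pv_int]])
    have "\<bar>p x * norm (v x)\<bar> \<le> \<bar>p x + p x * (norm (v x))\<^sup>2\<bar>" for x
    proof -
      have "norm (v x) \<le> 1 + (norm (v x))\<^sup>2"
        using zero_le_power2[of "norm (v x) - 1 / 2"] by (simp add: power2_eq_square algebra_simps)
      then have "p x * norm (v x) \<le> p x * (1 + (norm (v x))\<^sup>2)" using p_pos[of x] by (intro mult_left_mono) auto
      then show ?thesis using p_pos[of x] by (simp add: abs_mult algebra_simps)
    qed
    then show "AE x in lborel. norm (p x * norm (v x)) \<le> norm (p x + p x * (norm (v x))\<^sup>2)" by simp
  qed measurable
  define J where "J = (\<integral>x. p x * norm (v x) \<partial>lborel)"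
  have cutoff_meas [measurable]: "cutoff r \<in> borel_measurable (borel :: (real ^ 'n) measure)" for r
    unfolding cutoff_def by measurable
  have \<eta>G_int: "integrable lborel (\<lambda>x. cutoff r x * G x)" for r
  proof (rule Bochner_Integration.integrable_bound[OF G_int])
    show "AE x in lborel. norm (cutoff r x * G x) \<le> norm (G x)"
      using abs_cutoff_mult_le by (intro AE_I2) simp
  qed (use G_int in measurable)
  have cut: "(\<integral>x. cutoff r x * G x \<partial>lborel) \<le> 4 / r * J" if r: "r > 0" for r
  proof -
    define g where "g x = cutoff r x * p x * ((norm (v x))\<^sup>2 - x \<bullet> v x - M)
      - 4 * max 0 (1 - (norm x)\<^sup>2 / r\<^sup>2) * (x \<bullet> v x) / r\<^sup>2 * p x" for x
    have g: "integrable lborel g" "(\<integral>x. g x \<partial>lborel) \<le> 0"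
      using weighted_divergence_cutoff[OF f' v' lap r \<kappa>] unfolding g_def p_def by auto
    have "cutoff r x * G x - 4 / r * (p x * norm (v x)) \<le> g x" for x
    proof -
      define m where "m = max 0 (1 - (norm x)\<^sup>2 / r\<^sup>2)"
      have m: "0 \<le> m" "m \<le> 1" by (auto simp: m_def)
      \<comment> \<open>\<open>m\<close> is at most 1 and vanishes from radius \<open>r\<close> on,
        so \<open>4 * m * norm x / r\<^sup>2\<close> is at most \<open>4 / r\<close>.\<close>
      have "m * norm x \<le> r"
      proof (cases "r \<le> norm x")
        case True then show ?thesis using cutoff_eq_0(1)[OF r True] r by (simp add: m_def)
      next
        case False
        then show ?thesis using mult_left_le_one_le[of "norm x" m] m by simp
      qed
      have "m * (x \<bullet> v x) \<le> m * (norm x * norm (v x))"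
        using m by (intro mult_left_mono norm_cauchy_schwarz)
      also have "\<dots> \<le> r * norm (v x)" using \<open>m * norm x \<le> r\<close> by (simp add: mult.assoc[symmetric] mult_right_mono)
      finally have "4 * (m * (x \<bullet> v x)) / r\<^sup>2 * p x \<le> 4 * (r * norm (v x)) / r\<^sup>2 * p x"
        using p_pos[of x] by (intro mult_right_mono divide_right_mono mult_left_mono) auto
      also have "\<dots> = 4 / r * (p x * norm (v x))" using r by (simp add: power2_eq_square)
      finally have "4 * (m * (x \<bullet> v x)) / r\<^sup>2 * p x \<le> 4 / r * (p x * norm (v x))" .
      moreover have "cutoff r x * G x \<le> cutoff r x * (p x * ((norm (v x))\<^sup>2 - x \<bullet> v x - M))"
        using cutoff_bounds G_le by (intro mult_left_mono)
      ultimately show ?thesis by (simp add: g_def m_def mult.assoc)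
    qed
    then have "(\<integral>x. cutoff r x * G x - 4 / r * (p x * norm (v x)) \<partial>lborel) \<le> (\<integral>x. g x \<partial>lborel)"
      using \<eta>G_int pv1_int g(1) by (intro integral_mono Bochner_Integration.integrable_diff integrable_mult_right)
    then show ?thesis using g(2) \<eta>G_int pv1_int by (simp add: J_def)
  qed
  \<comment> \<open>The radii run through \<open>real (Suc n)\<close> because \<open>cut\<close>
    needs a positive radius.\<close>
  have "(\<lambda>n. \<integral>x. cutoff (real (Suc n)) x * G x \<partial>lborel) \<longlonglongrightarrow> (\<integral>x. G x \<partial>lborel)"
  proof (rule integral_dominated_convergence[where w = "\<lambda>x. \<bar>G x\<bar>"])
    show "AE x in lborel. (\<lambda>n. cutoff (real (Suc n)) x * G x) \<longlonglongrightarrow> G x"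
    proof (rule AE_I2)
      fix x
      show "(\<lambda>n. cutoff (real (Suc n)) x * G x) \<longlonglongrightarrow> G x"
        using tendsto_mult[OF tendsto_cutoff[of x] tendsto_const[of "G x"]] by simp
    qed
    show "AE x in lborel. norm (cutoff (real (Suc n)) x * G x) \<le> \<bar>G x\<bar>" for n
      using abs_cutoff_mult_le by (intro AE_I2) simp
  qed (use G_int \<eta>G_int in auto)
  moreover have "(\<lambda>n. 4 / real (Suc n) * J) \<longlonglongrightarrow> 0"
    using tendsto_mult_right_zero[OF LIMSEQ_inverse_real_of_nat, of "4 * J"]
    by (simp add: inverse_eq_divide mult_ac)
  ultimately have "(\<integral>x. G x \<partial>lborel) \<le> 0"
    by (rule LIMSEQ_le) (use cut in auto)
  also have "(\<integral>x. G x \<partial>lborel) = (\<integral>x. p x * (norm (v x))\<^sup>2 \<partial>lborel) / 2 - (\<integral>x. p x * f x \<partial>lborel)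
      - (M + D - 1) - exp (- D) * (\<integral>x. \<psi> x \<partial>lborel)"
    unfolding G_def using pv_int pf_int p_int \<psi>_int p_one by simp
  \<comment> \<open>The bracket is nonpositive by Vitale's inequality,
    \<open>\<psi>_le\<close>.\<close>
  finally have "(\<integral>x. p x * (norm (v x))\<^sup>2 \<partial>lborel) / 2
      \<le> (\<integral>x. p x * f x \<partial>lborel) + M + D + (exp (- D) * (\<integral>x. \<psi> x \<partial>lborel) - 1)" by simp
  also have "exp (- D) * (\<integral>x. \<psi> x \<partial>lborel) \<le> exp (- D) * exp D"
    using \<psi>_le by (intro mult_left_mono) auto
  finally have "(\<integral>x. p x * (norm (v x))\<^sup>2 \<partial>lborel) / 2 \<le> (\<integral>x. p x * f x \<partial>lborel) + M + D"
    by (simp add: exp_minus)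
  moreover have "fisher_information \<nu> f = (\<integral>x. p x * (norm (v x))\<^sup>2 \<partial>lborel)"
    unfolding fisher_information_def v_def[symmetric] by (rule int_eq) measurable
  moreover have "KL_divergence (exp 1) std_gaussian \<nu> = (\<integral>x. p x * f x \<partial>lborel)"
    using int_eq[of f] KL_divergence_exp_density[of f] by (simp add: \<nu>)
  ultimately show ?thesis by (simp add: D_def)
qed

end
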